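(* Let $G$ be a finite group such that $\Gamma(G)$ is planar. Then $G$ is one of the following: (1) $G\cong\mathbb{Z}_5$; (2) $G$ is a cyclic $3$-group; (3) $G$ is a $2$-group with exactly one or exactly three elements of order $2$; (4) $|G|=2^m3^n$ for some integers $m,n$, and $G$ has a unique subgroup of order $2$ and a unique subgroup of order $3$.
   Context: For a finite group $G$, the prime order element graph $\Gamma(G)$ is the simple undirected graph with vertex set $G$ in which two distinct vertices $x,y\in G$ are adjacent if and only if the order of the product $xy$ is a prime number. $\mathbb{Z}_m$ denotes the cyclic group of order $m$. The trivial group counts as a cyclic $3$-group (of order $3^0$). *)

theory Defs
  imports "HOL-Analysis.Analysis" "HOL-Algebra.Multiplicative_Group" "HOL-Computational_Algebra.Primes"
begin

text \<open>
  A simple undirected graph is a pair of a vertex set and a set of edges, each edge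
  being the two-element set of its end vertices.
\<close>

type_synonym 'a sgraph = "'a set \<times> 'a set set"

text \<open>
  A set comprehension over unordered pairs asks for \<open>xy\<close> or \<open>yx\<close> to have prime order;
  as \<open>xy\<close> and \<open>yx\<close> are conjugate this is the same condition, see
  \<open>prime_order_graph_adjacent\<close> below.
\<close>

definition prime_order_graph :: "('a, 'b) monoid_scheme \<Rightarrow> 'a sgraph" where
  "prime_order_graph G =
     (carrier G,
      {{x, y} | x y. x \<in> carrier G \<and> y \<in> carrier G \<and> x \<noteq> y \<and> prime (group.ord G (x \<otimes>\<^bsub>G\<^esub> y))})"

text \<open>
  A drawing in the Euclidean plane (represented by the complex numbers) without crossings:
  \<open>p\<close> places the vertices at distinct points and \<open>c\<close> sends every edge to a Jordan arc joining
  the points of its two ends; an arc contains no vertex points other than its two ends, and two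
  different arcs meet only in the points of the common ends of their edges.
\<close>

definition plane_drawing :: "'a sgraph \<Rightarrow> ('a \<Rightarrow> complex) \<Rightarrow> ('a set \<Rightarrow> real \<Rightarrow> complex) \<Rightarrow> bool" where
  "plane_drawing \<Gamma> p c \<longleftrightarrow>
     inj_on p (fst \<Gamma>) \<and>
     (\<forall>e \<in> snd \<Gamma>. arc (c e) \<and> {pathstart (c e), pathfinish (c e)} = p ` e
                  \<and> path_image (c e) \<inter> p ` fst \<Gamma> = p ` e) \<and>
     (\<forall>e \<in> snd \<Gamma>. \<forall>f \<in> snd \<Gamma>. e \<noteq> f \<longrightarrow>
        path_image (c e) \<inter> path_image (c f) = p ` (e \<inter> f))"

definition planar :: "'a sgraph \<Rightarrow> bool" where
  "planar \<Gamma> \<longleftrightarrow> (\<exists>p c. plane_drawing \<Gamma> p c)"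

lemma (in group) ord_mult_commute:
  assumes x: "x \<in> carrier G" and y: "y \<in> carrier G"
  shows "ord (x \<otimes> y) = ord (y \<otimes> x)"
proof -
  have shift: "(a \<otimes> b) [^] n \<otimes> a = a \<otimes> (b \<otimes> a) [^] n"
    if "a \<in> carrier G" "b \<in> carrier G" for a b and n :: nat
  proof (induction n)
    case (Suc n)
    have "(a \<otimes> b) [^] Suc n \<otimes> a = (a \<otimes> b) [^] n \<otimes> a \<otimes> (b \<otimes> a)"
      using that by (simp add: m_assoc)
    also have "\<dots> = a \<otimes> (b \<otimes> a) [^] Suc n"
      using that Suc.IH by (simp add: m_assoc)
    finally show ?case .
  qed (use that in simp)
  have imp: "(b \<otimes> a) [^] n = \<one>"
    if "a \<in> carrier G" "b \<in> carrier G" "(a \<otimes> b) [^] n = \<one>" for a b and n :: nat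
  proof -
    have "a \<otimes> (b \<otimes> a) [^] n = a \<otimes> \<one>"
      using shift[of a b n] that by simp
    then show ?thesis
      using that by (simp del: r_one)
  qed
  have "(x \<otimes> y) [^] n = \<one> \<longleftrightarrow> (y \<otimes> x) [^] n = \<one>" for n :: nat
    using imp x y by blast
  then have "ord (x \<otimes> y) dvd n \<longleftrightarrow> ord (y \<otimes> x) dvd n" for n :: nat
    using pow_eq_id x y by (metis m_closed)
  then show ?thesis
    by (meson dvd_antisym dvd_refl)
qed

lemma (in group) prime_order_graph_adjacent:
  assumes "x \<in> carrier G" and "y \<in> carrier G"
  shows "{x, y} \<in> snd (prime_order_graph G) \<longleftrightarrow> x \<noteq> y \<and> prime (ord (x \<otimes> y))"
  using assms ord_mult_commute[of x y]
  by (auto simp: prime_order_graph_def doubleton_eq_iff)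

end

(*
  A planar graph contains no subdivision of K_{3,3}: a path through one of the three hubs joins two of
  the branch points on the other side, so the hubs give a theta curve, and the third branch point lies
  in a face whose closure misses the inside of one of the three arcs.

  In the graph of G every p of prime order joins x to inv x * p, so configurations of elements of
  prime order produce subdivided K_{3,3}'s: an element of prime order at least 7, two non-commuting
  involutions, eight elements forming an elementary abelian 2-group, two different subgroups of order
  3, an element of order 3 together with two involutions, and an element of order 5 in a larger group.
  What survives is the list of the theorem; a 3-group with a single subgroup of order 3 is cyclic.
*)

theory Submission
  imports Defs "HOL-Algebra.Sylow" "HOL-Number_Theory.Cong"
begin

section \<open>Theta curves and \<open>K\<^sub>3\<^sub>,\<^sub>3\<close> in the plane\<close>

text \<open>Planarity is only ever refuted, so a single kind of obstruction, a subdivided K_{3,3},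
  is enough. Inside a cyclic or elementary abelian subgroup few products fail to have prime order;
  branch vertices are placed so that almost all of the nine products are good, and each bad one is
  bypassed by a path through further elements. When the generators commute, an element is
  represented by its exponents, so distinctness of vertices and primality of orders become
  divisibility questions. A subgroup of order 5 has only five vertices, one fewer than K_{3,3}
  needs, which is why it can survive. An element \<open>x\<close> outside it supplies six or more
  vertices in two disjoint cosets; if these cosets are not disjoint, it supplies an involution
  instead. Involutions next to an element \<open>a\<close> of order 3 or 5 are controlled by
  conjugation: there are at most three of them, so \<open>a\<close> either fixes an involution or
  moves three of them in a cycle. For order 3 this leaves the direct product with a Klein four-group
  or the alternating group on four letters; for order 5 the cycle is impossible, since 3 is
  invertible modulo 5.\<close>

lemma Jordan_theta_pair:
  fixes c1 c2 :: "real \<Rightarrow> complex"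
  assumes "arc c1" "pathstart c1 = a" "pathfinish c1 = b"
    and "arc c2" "pathstart c2 = a" "pathfinish c2 = b"
    and "path_image c1 \<inter> path_image c2 = {a, b}"
  defines "J \<equiv> path_image c1 \<union> path_image c2"
  shows "inside J \<noteq> {}" "open (inside J)" "connected (inside J)"
    "open (outside J)" "connected (outside J)"
    "inside J \<union> outside J = - J" "frontier (inside J) = J" "frontier (outside J) = J"
proof -
  define g where "g = c1 +++ reversepath c2"
  have "simple_path g"
    unfolding g_def using assms
    by (intro simple_path_join_loop) (auto simp: arc_reversepath)
  moreover have "pathfinish g = pathstart g"
    unfolding g_def using assms by simp
  moreover have "path_image g = J"
    unfolding g_def J_def using assms by (simp add: path_image_join)
  ultimately show "inside J \<noteq> {}" "open (inside J)" "connected (inside J)"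
    "open (outside J)" "connected (outside J)"
    "inside J \<union> outside J = - J" "frontier (inside J) = J" "frontier (outside J) = J"
    using Jordan_inside_outside[of g] by auto
qed

lemma connected_subset_disjoint_open:
  assumes "connected D" "D \<subseteq> U \<union> V" "open U" "open V" "U \<inter> V = {}"
  shows "D \<subseteq> U \<or> D \<subseteq> V"
  using connectedD[OF assms(1,3,4)] assms(2,5) by blast

lemma arc_image_not_subset_ends:
  fixes c :: "real \<Rightarrow> 'a::metric_space"
  assumes "arc c" "pathstart c = a" "pathfinish c = b"
  shows "\<not> path_image c \<subseteq> {a, b}"
proof
  assume "path_image c \<subseteq> {a, b}"
  then have "finite (path_image c)"
    by (simp add: finite_subset)
  then have "path_image c = {} \<or> (\<exists>x. path_image c = {x})"
    using assms(1) connected_arc_image connected_finite_iff_sing by blast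
  moreover have "a \<in> path_image c" "b \<in> path_image c" "a \<noteq> b"
    using assms arc_distinct_ends[OF assms(1)] by auto
  ultimately show False
    by auto
qed

text \<open>
  Otherwise the three insides are pairwise disjoint, so a point inside \<open>c1 \<union> c3\<close> is separated from
  infinity neither by \<open>c1 \<union> c2\<close> nor by \<open>c2 \<union> c3\<close>; as these two curves meet in the connected set \<open>c2\<close>,
  Janiszewski's theorem gives a contradiction.
\<close>

lemma theta_separating_pair:
  fixes c1 c2 c3 :: "real \<Rightarrow> complex"
  assumes c1: "arc c1" "pathstart c1 = a" "pathfinish c1 = b"
    and c2: "arc c2" "pathstart c2 = a" "pathfinish c2 = b"
    and c3: "arc c3" "pathstart c3 = a" "pathfinish c3 = b"
    and c12: "path_image c1 \<inter> path_image c2 = {a, b}"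
    and c13: "path_image c1 \<inter> path_image c3 = {a, b}"
    and c23: "path_image c2 \<inter> path_image c3 = {a, b}"
  shows "path_image c3 \<inter> inside (path_image c1 \<union> path_image c2) \<noteq> {}
    \<or> path_image c2 \<inter> inside (path_image c1 \<union> path_image c3) \<noteq> {}
    \<or> path_image c1 \<inter> inside (path_image c2 \<union> path_image c3) \<noteq> {}"
proof (rule ccontr)
  define T1 T2 T3 where "T1 = path_image c1" and "T2 = path_image c2" and "T3 = path_image c3"
  note J12 = Jordan_theta_pair[OF c1 c2 c12, folded T1_def T2_def]
  note J13 = Jordan_theta_pair[OF c1 c3 c13, folded T1_def T3_def]
  note J23 = Jordan_theta_pair[OF c2 c3 c23, folded T2_def T3_def]
  note J31 = J13[unfolded Un_commute[of T1 T3]]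
  note J32 = J23[unfolded Un_commute[of T2 T3]]
  have int: "T1 \<inter> T2 = {a, b}" "T1 \<inter> T3 = {a, b}" "T2 \<inter> T3 = {a, b}"
    using c12 c13 c23 by (simp_all add: T1_def T2_def T3_def)
  assume "\<not> ?thesis"
  then have n12: "T3 \<inter> inside (T1 \<union> T2) = {}" and n13: "T2 \<inter> inside (T1 \<union> T3) = {}"
    and n23: "T1 \<inter> inside (T2 \<union> T3) = {}"
    by (auto simp: T1_def T2_def T3_def)
  \<comment> \<open>Each of the two insides avoids the boundary of the other, so if they overlapped
    they would coincide, and so would their frontiers \<open>A \<union> B\<close> and
    \<open>A \<union> C\<close>. The shared arc \<open>A\<close> is a variable because the argument
    is needed for \<open>T1\<close> and for \<open>T3\<close>.\<close>
  have disjoint: "inside (A \<union> B) \<inter> inside (A \<union> C) = {}"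
    if "inside (A \<union> B) \<union> outside (A \<union> B) = - (A \<union> B)" "inside (A \<union> C) \<union> outside (A \<union> C) = - (A \<union> C)"
      "open (inside (A \<union> B))" "open (outside (A \<union> B))" "open (inside (A \<union> C))" "open (outside (A \<union> C))"
      "connected (inside (A \<union> B))" "connected (inside (A \<union> C))"
      "frontier (inside (A \<union> B)) = A \<union> B" "frontier (inside (A \<union> C)) = A \<union> C"
      "C \<inter> inside (A \<union> B) = {}" "B \<inter> inside (A \<union> C) = {}" "\<not> B \<subseteq> {a, b}" "A \<inter> B = {a, b}" "B \<inter> C = {a, b}"
    for A B C :: "complex set"
  proof (rule ccontr)
    assume meet: "inside (A \<union> B) \<inter> inside (A \<union> C) \<noteq> {}"
    have "inside (A \<union> B) \<subseteq> inside (A \<union> C) \<union> outside (A \<union> C)"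
      "inside (A \<union> C) \<subseteq> inside (A \<union> B) \<union> outside (A \<union> B)"
      using that(1,2,11,12) inside_no_overlap[of "A \<union> B"] inside_no_overlap[of "A \<union> C"] by blast+
    then have "inside (A \<union> B) \<subseteq> inside (A \<union> C) \<or> inside (A \<union> B) \<subseteq> outside (A \<union> C)"
      "inside (A \<union> C) \<subseteq> inside (A \<union> B) \<or> inside (A \<union> C) \<subseteq> outside (A \<union> B)"
      using connected_subset_disjoint_open that(3-8) inside_Int_outside by metis+
    then have "inside (A \<union> B) = inside (A \<union> C)"
      using meet inside_Int_outside[of "A \<union> B"] inside_Int_outside[of "A \<union> C"] by blast
    then have "A \<union> B = A \<union> C"
      using that(9,10) by metis
    then have "B \<subseteq> (A \<inter> B) \<union> (B \<inter> C)"
      by blast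
    then show False
      using that(13-15) by simp
  qed
  have e2: "\<not> T2 \<subseteq> {a, b}" and e1: "\<not> T1 \<subseteq> {a, b}"
    using arc_image_not_subset_ends[OF c1] arc_image_not_subset_ends[OF c2] by (simp_all add: T1_def T2_def)
  obtain p where p: "p \<in> inside (T1 \<union> T3)"
    using J13(1) by blast
  have "inside (T1 \<union> T2) \<inter> inside (T1 \<union> T3) = {}"
    by (rule disjoint[OF J12(6) J13(6) J12(2) J12(4) J13(2) J13(4) J12(3) J13(3) J12(7) J13(7)
          n12 n13 e2 int(1) int(3)])
  moreover have "inside (T3 \<union> T1) \<inter> inside (T3 \<union> T2) = {}"
    by (rule disjoint[OF J31(6) J32(6) J31(2) J31(4) J32(2) J32(4) J31(3) J32(3) J31(7) J32(7)
          n13[unfolded Un_commute[of T1 T3]] n23[unfolded Un_commute[of T2 T3]] e1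
          int(2)[unfolded Int_commute[of T1 T3]] int(1)])
  ultimately have "p \<notin> inside (T1 \<union> T2)" "p \<notin> inside (T2 \<union> T3)"
    using p by (metis IntI Un_commute empty_iff)+
  moreover have "p \<notin> T1" "p \<notin> T2" "p \<notin> T3"
    using p n13 inside_no_overlap[of "T1 \<union> T3"] by blast+
  ultimately have pO: "p \<in> outside (T1 \<union> T2)" "p \<in> outside (T2 \<union> T3)"
    by (simp_all add: inside_outside)
  have "bounded (T1 \<union> T2 \<union> T3)"
    by (simp add: T1_def T2_def T3_def bounded_arc_image c1 c2 c3)
  then obtain q where q: "q \<in> outside (T1 \<union> T2 \<union> T3)"
    using outside_bounded_nonempty by blast
  have qO: "q \<in> outside (T1 \<union> T2)" "q \<in> outside (T2 \<union> T3)" "q \<in> outside (T1 \<union> T3)"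
    using q outside_mono[of "T1 \<union> T2" "T1 \<union> T2 \<union> T3"] outside_mono[of "T2 \<union> T3" "T1 \<union> T2 \<union> T3"]
      outside_mono[of "T1 \<union> T3" "T1 \<union> T2 \<union> T3"] by blast+
  have "connected_component (- ((T1 \<union> T2) \<union> (T2 \<union> T3))) p q"
  proof (rule Janiszewski)
    show "compact (T1 \<union> T2)" "closed (T2 \<union> T3)"
      using c1 c2 c3 by (auto simp: T1_def T2_def T3_def compact_arc_image closed_arc_image)
    have "(T1 \<union> T2) \<inter> (T2 \<union> T3) = T2"
      using int by blast
    then show "connected ((T1 \<union> T2) \<inter> (T2 \<union> T3))"
      using c2 by (simp add: T2_def connected_arc_image)
    show "connected_component (- (T1 \<union> T2)) p q"
      unfolding connected_component_def
      using J12(5) pO(1) qO(1) outside_no_overlap[of "T1 \<union> T2"] by blast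
    show "connected_component (- (T2 \<union> T3)) p q"
      unfolding connected_component_def
      using J23(5) pO(2) qO(2) outside_no_overlap[of "T2 \<union> T3"] by blast
  qed
  then have "connected_component (- (T1 \<union> T3)) p q"
    by (rule connected_component_of_subset) auto
  then show False
    using p qO(3) by (metis DiffD1 disjoint_iff inside_Int_outside inside_same_component)
qed

text \<open>\<open>c3\<close> is a cross-cut of the disc inside \<open>c1 \<union> c2\<close> and
  divides it in two. The complement of the theta curve thus has three pieces, each bounded by two of
  the arcs and touching the remaining one at most in \<open>a\<close> and \<open>b\<close>; a
  connected \<open>D\<close> stays within one piece.\<close>

lemma theta_face_split:
  fixes c1 c2 c3 :: "real \<Rightarrow> complex"
  assumes c1: "arc c1" "pathstart c1 = a" "pathfinish c1 = b"
    and c2: "arc c2" "pathstart c2 = a" "pathfinish c2 = b"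
    and c3: "arc c3" "pathstart c3 = a" "pathfinish c3 = b"
    and c12: "path_image c1 \<inter> path_image c2 = {a, b}"
    and c13: "path_image c1 \<inter> path_image c3 = {a, b}"
    and c23: "path_image c2 \<inter> path_image c3 = {a, b}"
    and ins: "path_image c3 \<inter> inside (path_image c1 \<union> path_image c2) \<noteq> {}"
    and D: "connected D" "D \<inter> (path_image c1 \<union> path_image c2 \<union> path_image c3) = {}"
  shows "closure D \<inter> path_image c1 \<subseteq> {a, b} \<or> closure D \<inter> path_image c2 \<subseteq> {a, b}
    \<or> closure D \<inter> path_image c3 \<subseteq> {a, b}"
proof -
  define T1 T2 T3 where "T1 = path_image c1" and "T2 = path_image c2" and "T3 = path_image c3"
  note J12 = Jordan_theta_pair[OF c1 c2 c12, folded T1_def T2_def]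
  note J13 = Jordan_theta_pair[OF c1 c3 c13, folded T1_def T3_def]
  note J23 = Jordan_theta_pair[OF c2 c3 c23, folded T2_def T3_def]
  have int: "T1 \<inter> T2 = {a, b}" "T1 \<inter> T3 = {a, b}" "T2 \<inter> T3 = {a, b}"
    using c12 c13 c23 by (simp_all add: T1_def T2_def T3_def)
  have "a \<noteq> b"
    using c1 arc_distinct_ends by blast
  then have split: "inside (T1 \<union> T3) \<union> inside (T2 \<union> T3) \<union> (T3 - {a, b}) = inside (T1 \<union> T2)"
    using split_inside_simple_closed_curve[OF arc_imp_simple_path[OF c1(1)] c1(2,3)
        arc_imp_simple_path[OF c2(1)] c2(2,3) arc_imp_simple_path[OF c3(1)] c3(2,3) _ c12 c13 c23 ins]
    unfolding T1_def T2_def T3_def by metis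
  have clos: "closure D \<subseteq> U \<union> J" if "D \<subseteq> U" "frontier U = J" for U J
    using closure_mono[OF that(1)] that(2) closure_Un_frontier[of U] by blast
  have "D \<subseteq> inside (T1 \<union> T3) \<or> D \<subseteq> outside (T1 \<union> T3)"
    "D \<subseteq> inside (T2 \<union> T3) \<or> D \<subseteq> outside (T2 \<union> T3)"
    "D \<subseteq> inside (T1 \<union> T2) \<or> D \<subseteq> outside (T1 \<union> T2)"
    using D J13 J23 J12 by (intro connected_subset_disjoint_open; auto simp: T1_def T2_def T3_def)+
  moreover have "D \<inter> inside (T1 \<union> T2) \<subseteq> inside (T1 \<union> T3) \<union> inside (T2 \<union> T3)"
    using split D by (auto simp: T3_def)
  ultimately consider "D \<subseteq> inside (T1 \<union> T3)" | "D \<subseteq> inside (T2 \<union> T3)" | "D \<subseteq> outside (T1 \<union> T2)"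
    using inside_Int_outside[of "T1 \<union> T3"] inside_Int_outside[of "T2 \<union> T3"] by blast
  then show ?thesis
  proof cases
    case 1
    have "T2 \<inter> inside (T1 \<union> T3) = {}"
      using split inside_no_overlap[of "T1 \<union> T2"] by blast
    moreover have "T2 \<inter> (T1 \<union> T3) = {a, b}"
      using int by blast
    ultimately have "closure D \<inter> T2 \<subseteq> {a, b}"
      using clos[OF 1 J13(7)] by blast
    then show ?thesis by (simp add: T2_def)
  next
    case 2
    have "T1 \<inter> inside (T2 \<union> T3) = {}"
      using split inside_no_overlap[of "T1 \<union> T2"] by blast
    moreover have "T1 \<inter> (T2 \<union> T3) = {a, b}"
      using int by blast
    ultimately have "closure D \<inter> T1 \<subseteq> {a, b}"
      using clos[OF 2 J23(7)] by blast
    then show ?thesis by (simp add: T1_def)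
  next
    case 3
    have "T3 \<subseteq> {a, b} \<union> inside (T1 \<union> T2)"
      using split by blast
    then have "T3 \<inter> outside (T1 \<union> T2) \<subseteq> {a, b}"
      using inside_Int_outside[of "T1 \<union> T2"] outside_no_overlap[of "T1 \<union> T2"] by blast
    moreover have "T3 \<inter> (T1 \<union> T2) = {a, b}"
      using int by blast
    ultimately have "closure D \<inter> T3 \<subseteq> {a, b}"
      using clos[OF 3 J12(8)] by blast
    then show ?thesis by (simp add: T3_def)
  qed
qed

text \<open>Some labelling of the three arcs makes one of them a cross-cut of the other two, and the
  conclusion is symmetric in the labels.\<close>

lemma theta_face:
  fixes c1 c2 c3 :: "real \<Rightarrow> complex"
  assumes "arc c1" "pathstart c1 = a" "pathfinish c1 = b"
    and "arc c2" "pathstart c2 = a" "pathfinish c2 = b"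
    and "arc c3" "pathstart c3 = a" "pathfinish c3 = b"
    and "path_image c1 \<inter> path_image c2 = {a, b}"
    and "path_image c1 \<inter> path_image c3 = {a, b}"
    and "path_image c2 \<inter> path_image c3 = {a, b}"
    and "connected D" "D \<inter> (path_image c1 \<union> path_image c2 \<union> path_image c3) = {}"
  shows "closure D \<inter> path_image c1 \<subseteq> {a, b} \<or> closure D \<inter> path_image c2 \<subseteq> {a, b}
    \<or> closure D \<inter> path_image c3 \<subseteq> {a, b}"
proof -
  consider "path_image c3 \<inter> inside (path_image c1 \<union> path_image c2) \<noteq> {}"
    | "path_image c2 \<inter> inside (path_image c1 \<union> path_image c3) \<noteq> {}"
    | "path_image c1 \<inter> inside (path_image c2 \<union> path_image c3) \<noteq> {}"
    using theta_separating_pair[OF assms(1-12)] by argo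
  then show ?thesis
  proof cases
    case 1
    then show ?thesis
      using theta_face_split[OF assms(1-12) 1 assms(13,14)] by argo
  next
    case 2
    have "D \<inter> (path_image c1 \<union> path_image c3 \<union> path_image c2) = {}"
      using assms(14) by (simp add: Un_ac)
    then show ?thesis
      using theta_face_split[OF assms(1-3,7-9,4-6,11,10) _ 2 assms(13)] assms(12)
      by (simp add: Int_commute) argo
  next
    case 3
    have "D \<inter> (path_image c2 \<union> path_image c3 \<union> path_image c1) = {}"
      using assms(14) by (simp add: Un_ac)
    then show ?thesis
      using theta_face_split[OF assms(4-9,1-3,12) _ _ 3 assms(13)] assms(10,11)
      by (simp add: Int_commute) argo
  qed
qed

text \<open>This lets the far ends of a star of arcs be removed without losing connectedness, while
  the ends remain limit points.\<close>

lemma arc_minus_finish: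
  fixes g :: "real \<Rightarrow> 'a::metric_space"
  assumes "arc g"
  shows "connected (path_image g - {pathfinish g})"
    and "pathfinish g \<in> closure (path_image g - {pathfinish g})"
proof -
  have cont: "continuous_on {0..1} g" and inj: "inj_on g {0..1}"
    using assms by (auto simp: arc_def path_def)
  have eq: "path_image g - {pathfinish g} = g ` {0..<1}"
  proof -
    have "g ` {0..<1} = g ` ({0..1} - {1})"
      by (rule arg_cong[where f = "image g"]) auto
    also have "\<dots> = g ` {0..1} - g ` {1}"
      using inj by (intro inj_on_image_set_diff) auto
    finally show ?thesis
      by (simp add: path_image_def pathfinish_def)
  qed
  show "connected (path_image g - {pathfinish g})"
    unfolding eq
    by (rule connected_continuous_image[OF continuous_on_subset[OF cont]]) (simp_all add: subset_iff)
  have "g ` closure {0..<1} \<subseteq> closure (g ` {0..<1})"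
    by (rule image_closure_subset) (simp_all add: cont closure_subset)
  then have "g 1 \<in> closure (g ` {0..<1})"
    by auto
  then show "pathfinish g \<in> closure (path_image g - {pathfinish g})"
    unfolding eq by (simp add: pathfinish_def)
qed

lemma no_K33_arcs:
  fixes x y :: "nat \<Rightarrow> complex" and g :: "nat \<Rightarrow> nat \<Rightarrow> real \<Rightarrow> complex"
  assumes arcs: "\<And>i j. i < 3 \<Longrightarrow> j < 3 \<Longrightarrow> arc (g i j) \<and> pathstart (g i j) = x i \<and> pathfinish (g i j) = y j"
    and int: "\<And>i j k l. i < 3 \<Longrightarrow> j < 3 \<Longrightarrow> k < 3 \<Longrightarrow> l < 3 \<Longrightarrow> (i, j) \<noteq> (k, l) \<Longrightarrow>
      path_image (g i j) \<inter> path_image (g k l) = (if i = k then {x i} else if j = l then {y j} else {})"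
  shows False
proof -
  have g: "arc (g i j)" "pathstart (g i j) = x i" "pathfinish (g i j) = y j" if "i < 3" "j < 3" for i j
    using arcs[OF that] by blast+
  have lt: "(0::nat) < 3" "(1::nat) < 3" "(2::nat) < 3"
    by simp_all
  have int_x: "path_image (g i j) \<inter> path_image (g i l) = {x i}" if "i < 3" "j < 3" "l < 3" "j \<noteq> l" for i j l
    using int[of i j i l] that by simp
  have int_y: "path_image (g i j) \<inter> path_image (g k j) = {y j}" if "i < 3" "j < 3" "k < 3" "i \<noteq> k" for i j k
    using int[of i j k j] that by simp
  have int_0: "path_image (g i j) \<inter> path_image (g k l) = {}"
    if "i < 3" "j < 3" "k < 3" "l < 3" "i \<noteq> k" "j \<noteq> l" for i j k l
    using int[of i j k l] that by simp
  define c where "c j = g 0 j +++ reversepath (g 1 j)" for j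
  have pc: "path_image (c j) = path_image (g 0 j) \<union> path_image (g 1 j)" if "j < 3" for j
    unfolding c_def by (simp add: path_image_join g[OF lt(1) that] g[OF lt(2) that] del: One_nat_def)
  have c: "arc (c j)" "pathstart (c j) = x 0" "pathfinish (c j) = x 1" if "j < 3" for j
    unfolding c_def using int_y[OF lt(1) that lt(2)]
    by (auto intro!: arc_join arc_reversepath simp: g[OF lt(1) that] g[OF lt(2) that] simp del: One_nat_def)
  have cc: "path_image (c i) \<inter> path_image (c j) = {x 0, x 1}" if "i < 3" "j < 3" "i \<noteq> j" for i j
    unfolding pc[OF that(1)] pc[OF that(2)]
    using int_x[OF lt(1) that] int_x[OF lt(2) that] int_0[OF lt(1) that(1) lt(2) that(2) _ that(3)]
      int_0[OF lt(2) that(1) lt(1) that(2) _ that(3)]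
    by (simp add: Int_Un_distrib Int_Un_distrib2 insert_commute del: One_nat_def)
  \<comment> \<open>The star at the third branch point without the hubs: it is connected and avoids
    the theta curve, but every hub \<open>y j\<close> is a limit point of it. Since
    \<open>y j\<close> lies on \<open>c j\<close> away from \<open>x 0\<close> and
    \<open>x 1\<close>, \<open>theta_face\<close> is contradicted.\<close>
  define D where "D = (\<Union>j\<in>{..<3}. path_image (g 2 j) - {y j})"
  have x2: "x 2 \<in> path_image (g 2 j) - {y j}" if "j < 3" for j
    using g[OF lt(3) that] arc_distinct_ends[of "g 2 j"] pathstart_in_path_image[of "g 2 j"] by auto
  have "connected D"
    unfolding D_def
  proof (rule connected_Union)
    fix S assume "S \<in> (\<lambda>j. path_image (g 2 j) - {y j}) ` {..<3}"
    then obtain j where "j < 3" "S = path_image (g 2 j) - {y j}"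
      by auto
    then show "connected S"
      using arc_minus_finish(1)[of "g 2 j"] g[OF lt(3)] by simp
  next
    show "\<Inter> ((\<lambda>j. path_image (g 2 j) - {y j}) ` {..<3}) \<noteq> {}"
      using x2 by blast
  qed
  moreover have "D \<inter> path_image (c k) = {}" if "k < 3" for k
  proof -
    have "(path_image (g 2 j) - {y j}) \<inter> path_image (g i k) = {}" if "j < 3" "i < 3" "i \<noteq> 2" for i j
      using int_y[OF lt(3) \<open>k < 3\<close> that(2)] int_0[OF lt(3) that(1,2) \<open>k < 3\<close>] that(3)
      by (cases "j = k") auto
    from this[OF _ lt(1)] this[OF _ lt(2)] show ?thesis
      unfolding pc[OF that] D_def by fastforce
  qed
  ultimately have "closure D \<inter> path_image (c 0) \<subseteq> {x 0, x 1} \<or>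
      closure D \<inter> path_image (c 1) \<subseteq> {x 0, x 1} \<or> closure D \<inter> path_image (c 2) \<subseteq> {x 0, x 1}"
    by (intro theta_face[of "c 0" "x 0" "x 1" "c 1" "c 2" D] c cc) (simp_all add: Int_Un_distrib del: One_nat_def)
  then obtain j where j: "j < 3" "closure D \<inter> path_image (c j) \<subseteq> {x 0, x 1}"
    using lt by blast
  have "y j \<in> closure (path_image (g 2 j) - {y j})"
    using arc_minus_finish(2)[of "g 2 j"] g[OF lt(3) j(1)] by simp
  also have "\<dots> \<subseteq> closure D"
    unfolding D_def using j by (intro closure_mono) auto
  finally have "y j \<in> {x 0, x 1}"
    using j(2) g(3)[OF lt(1) j(1)] pc[OF j(1)] pathfinish_in_path_image[of "g 0 j"] by auto
  then show False
    using g[OF lt(1) j(1)] g[OF lt(2) j(1)] arc_distinct_ends by (metis insertE singletonD)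
qed

section \<open>Planar drawings\<close>

fun walk_edges :: "'a list \<Rightarrow> 'a set set" where
  "walk_edges (u # v # vs) = insert {u, v} (walk_edges (v # vs))"
| "walk_edges _ = {}"

lemma Union_walk_edges:
  "2 \<le> length vs \<Longrightarrow> \<Union> (walk_edges vs) = set vs"
proof (induction vs rule: walk_edges.induct)
  case (1 u v vs)
  then show ?case
    by (cases vs) auto
qed auto

lemma card_walk_edge:
  "distinct vs \<Longrightarrow> e \<in> walk_edges vs \<Longrightarrow> card e = 2"
  by (induction vs rule: walk_edges.induct) auto

text \<open>The first vertex of a distinct list lies on no later edge, so the arc of the first edge
  meets the rest of the path only in \<open>p v\<close>, and joining the two gives an arc
  again.\<close>

lemma plane_drawing_path_arc:
  assumes D: "plane_drawing \<Gamma> p c"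
  shows "walk_edges vs \<subseteq> snd \<Gamma> \<Longrightarrow> distinct vs \<Longrightarrow> 2 \<le> length vs \<Longrightarrow> set vs \<subseteq> fst \<Gamma> \<Longrightarrow>
    \<exists>g. arc g \<and> pathstart g = p (hd vs) \<and> pathfinish g = p (last vs) \<and>
      path_image g = (\<Union>e\<in>walk_edges vs. path_image (c e))"
proof (induction vs rule: walk_edges.induct)
  case (1 u v vs)
  have uv: "{u, v} \<in> snd \<Gamma>" "u \<noteq> v" "p u \<noteq> p v"
    using 1 D by (auto simp: plane_drawing_def inj_on_eq_iff)
  then have "arc (c {u, v})" "{pathstart (c {u, v}), pathfinish (c {u, v})} = {p u, p v}"
    using D by (auto simp: plane_drawing_def)
  \<comment> \<open>Edges are unordered: the arc may run from \<open>v\<close> to \<open>u\<close>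
    and is then reversed.\<close>
  then obtain h where h: "arc h" "pathstart h = p u" "pathfinish h = p v" "path_image h = path_image (c {u, v})"
    using arc_reversepath path_image_reversepath pathstart_reversepath pathfinish_reversepath
    by (metis doubleton_eq_iff)
  show ?case
  proof (cases vs)
    case Nil
    then show ?thesis
      using h by auto
  next
    case (Cons w ws)
    then obtain g where g: "arc g" "pathstart g = p v" "pathfinish g = p (last (v # vs))"
      "path_image g = (\<Union>e\<in>walk_edges (v # vs). path_image (c e))"
      using 1 by auto
    have "path_image h \<inter> path_image g \<subseteq> {p v}"
    proof
      fix z assume "z \<in> path_image h \<inter> path_image g"
      then obtain f where f: "f \<in> walk_edges (v # vs)" "z \<in> path_image (c {u, v}) \<inter> path_image (c f)"
        using h(4) g(4) by blast
      then have "f \<subseteq> set (v # vs)"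
        using Union_walk_edges[of "v # vs"] Cons by auto
      then have "u \<notin> f"
        using 1(3) by auto
      then have "path_image (c {u, v}) \<inter> path_image (c f) = p ` ({u, v} \<inter> f)"
        using D uv(1) f(1) 1(2) unfolding plane_drawing_def
        by (metis insertCI subsetD walk_edges.simps(1))
      then show "z \<in> {p v}"
        using f(2) \<open>u \<notin> f\<close> by auto
    qed
    then have "arc (h +++ g)" "path_image (h +++ g) = path_image h \<union> path_image g"
      using h g by (simp_all add: arc_join path_image_join)
    then show ?thesis
      using h g by (intro exI[of _ "h +++ g"]) auto
  qed
qed auto

lemma plane_drawing_Int:
  assumes D: "plane_drawing \<Gamma> p c" and E: "E \<subseteq> snd \<Gamma>" "F \<subseteq> snd \<Gamma>" "E \<inter> F = {}"
  shows "(\<Union>e\<in>E. path_image (c e)) \<inter> (\<Union>f\<in>F. path_image (c f)) = p ` (\<Union>E \<inter> \<Union>F)"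
proof -
  have meet: "path_image (c e) \<inter> path_image (c f) = p ` (e \<inter> f)" if "e \<in> E" "f \<in> F" for e f
    using D E that unfolding plane_drawing_def by (metis disjoint_iff subsetD)
  have "(\<Union>e\<in>E. path_image (c e)) \<inter> (\<Union>f\<in>F. path_image (c f)) =
      (\<Union>e\<in>E. \<Union>f\<in>F. path_image (c e) \<inter> path_image (c f))"
    by (rule Int_UN_distrib2)
  also have "\<dots> = (\<Union>e\<in>E. \<Union>f\<in>F. p ` (e \<inter> f))"
    using meet by (intro SUP_cong refl)
  also have "\<dots> = p ` (\<Union>e\<in>E. \<Union>f\<in>F. e \<inter> f)"
    by (simp only: image_UN)
  also have "(\<Union>e\<in>E. \<Union>f\<in>F. e \<inter> f) = \<Union>E \<inter> \<Union>F"
    by blast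
  finally show ?thesis .
qed

text \<open>The lists contain both end vertices, so internal disjointness of the nine paths is a
  single equation between vertex sets, of the same shape as the one for arcs in
  \<open>no_K33_arcs\<close>.\<close>

lemma planar_imp_no_K33_subdivision:
  fixes x y :: "nat \<Rightarrow> 'a" and L :: "nat \<Rightarrow> nat \<Rightarrow> 'a list"
  assumes "planar \<Gamma>"
    and path: "\<And>i j. i < 3 \<Longrightarrow> j < 3 \<Longrightarrow> walk_edges (L i j) \<subseteq> snd \<Gamma> \<and> distinct (L i j) \<and>
      2 \<le> length (L i j) \<and> set (L i j) \<subseteq> fst \<Gamma> \<and> hd (L i j) = x i \<and> last (L i j) = y j"
    and int: "\<And>i j k l. i < 3 \<Longrightarrow> j < 3 \<Longrightarrow> k < 3 \<Longrightarrow> l < 3 \<Longrightarrow> (i, j) \<noteq> (k, l) \<Longrightarrow>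
      set (L i j) \<inter> set (L k l) = (if i = k then {x i} else if j = l then {y j} else {})"
  shows False
proof -
  obtain p c where D: "plane_drawing \<Gamma> p c"
    using assms(1) by (auto simp: planar_def)
  define S where "S i j = (\<Union>e\<in>walk_edges (L i j). path_image (c e))" for i j
  have path_arc: "\<exists>g. arc g \<and> pathstart g = p (x i) \<and> pathfinish g = p (y j) \<and> path_image g = S i j"
    if "i < 3" "j < 3" for i j
    using plane_drawing_path_arc[OF D, of "L i j"] path[OF that] by (simp add: S_def)
  define g where "g i j = (SOME g. arc g \<and> pathstart g = p (x i) \<and> pathfinish g = p (y j) \<and> path_image g = S i j)"
    for i j
  have g: "arc (g i j)" "pathstart (g i j) = p (x i)" "pathfinish (g i j) = p (y j)"
    "path_image (g i j) = S i j" if "i < 3" "j < 3" for i j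
    using someI_ex[OF path_arc[OF that]] by (simp_all add: g_def)
  show False
  proof (rule no_K33_arcs)
    fix i j k l :: nat assume *: "i < 3" "j < 3" "k < 3" "l < 3" "(i, j) \<noteq> (k, l)"
    \<comment> \<open>Two paths with at most one common vertex share no edge, as an edge has two
      ends; hence their arcs meet only in drawn common vertices.\<close>
    have small: "card (set (L i j) \<inter> set (L k l)) \<le> 1"
      by (simp add: int[OF *])
    have U: "\<Union> (walk_edges (L i j)) = set (L i j)" "\<Union> (walk_edges (L k l)) = set (L k l)"
      using * path by (simp_all add: Union_walk_edges)
    have "False" if "e \<in> walk_edges (L i j)" "e \<in> walk_edges (L k l)" for e
    proof -
      have "e \<subseteq> set (L i j) \<inter> set (L k l)"
        using that U by blast
      then have "card e \<le> 1"
        using small by (meson card_mono finite_Int finite_set le_trans)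
      then show False
        using card_walk_edge[OF _ that(1)] path[OF *(1,2)] by simp
    qed
    then have "path_image (g i j) \<inter> path_image (g k l) = p ` (set (L i j) \<inter> set (L k l))"
      unfolding g(4)[OF *(1,2)] g(4)[OF *(3,4)] S_def
      using plane_drawing_Int[OF D, of "walk_edges (L i j)" "walk_edges (L k l)"] path * U by auto
    then show "path_image (g i j) \<inter> path_image (g k l) =
        (if i = k then {p (x i)} else if j = l then {p (y j)} else {})"
      by (simp add: int[OF *])
  qed (use g in auto)
qed

lemma disjoint_nth_if_distinct_concat:
  assumes "distinct (concat xs)" "m < length xs" "n < length xs" "m \<noteq> n"
  shows "set (xs ! m) \<inter> set (xs ! n) = {}"
proof -
  have "set (xs ! m) \<inter> set (xs ! n) = {}" if "m < n" "n < length xs" for m n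
  proof -
    have "xs = take n xs @ xs ! n # drop (Suc n) xs"
      using that by (simp add: id_take_nth_drop)
    then have "distinct (concat (take n xs @ xs ! n # drop (Suc n) xs))"
      using assms(1) by simp
    moreover have "xs ! m \<in> set (take n xs)"
      using that by (auto simp: in_set_conv_nth intro!: exI[of _ m])
    ultimately show ?thesis
      by auto
  qed
  then show ?thesis
    using assms by (metis Int_commute linorder_neqE_nat)
qed

section \<open>Non-planar configurations in groups\<close>

context group
begin

abbreviation adj :: "'a \<Rightarrow> 'a \<Rightarrow> bool" where
  "adj u v \<equiv> prime (ord (u \<otimes> v))"

text \<open>\<open>Is ! (3 * i + j)\<close> lists the inner vertices of the path from
  \<open>xs ! i\<close> to \<open>ys ! j\<close> and is empty for a direct edge. With flat lists,
  the hypotheses for a concrete subdivision unfold to finitely many inequalities and primality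
  conditions.\<close>

lemma nonplanar_K33_subdivision:
  assumes len: "length xs = 3" "length ys = 3" "length Is = 9"
    and dist: "distinct (xs @ ys @ concat Is)"
    and carr: "set (xs @ ys @ concat Is) \<subseteq> carrier G"
    and adj: "\<forall>i\<in>{0, 1, 2}. \<forall>j\<in>{0, 1, 2}. successively adj (xs ! i # Is ! (3 * i + j) @ [ys ! j])"
  shows "\<not> planar (prime_order_graph G)"
proof
  assume pl: "planar (prime_order_graph G)"
  define J where "J i j = Is ! (3 * i + j)" for i j
  define L where "L i j = xs ! i # J i j @ [ys ! j]" for i j
  have x: "xs ! i \<in> set xs" "i < 3 \<Longrightarrow> k < 3 \<Longrightarrow> xs ! i = xs ! k \<longleftrightarrow> i = k" if "i < 3" for i k
    using that len dist by (auto simp: nth_eq_iff_index_eq)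
  have y: "ys ! i \<in> set ys" "i < 3 \<Longrightarrow> k < 3 \<Longrightarrow> ys ! i = ys ! k \<longleftrightarrow> i = k" if "i < 3" for i k
    using that len dist by (auto simp: nth_eq_iff_index_eq)
  have J: "J i j \<in> set Is" if "i < 3" "j < 3" for i j
    unfolding J_def using that len by (intro nth_mem) linarith
  then have JI: "distinct (J i j)" "set (J i j) \<subseteq> set (concat Is)" if "i < 3" "j < 3" for i j
    using that dist by (auto simp: distinct_concat_iff)
  have xyJ: "set xs \<inter> set ys = {}" "set xs \<inter> set (concat Is) = {}" "set ys \<inter> set (concat Is) = {}"
    using dist by auto
  have xJ: "xs ! i \<notin> set (J k l)" and yJ: "ys ! i \<notin> set (J k l)" if "i < 3" "k < 3" "l < 3" for i k l
    using x(1)[OF that(1)] y(1)[OF that(1)] JI(2)[OF that(2,3)] xyJ(2,3) by (meson disjoint_iff subsetD)+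
  have xy: "xs ! i \<noteq> ys ! j" if "i < 3" "j < 3" for i j
    using x(1)[OF that(1)] y(1)[OF that(2)] xyJ(1) by (metis disjoint_iff)
  have JJ: "set (J i j) \<inter> set (J k l) = {}" if "i < 3" "j < 3" "k < 3" "l < 3" "(i, j) \<noteq> (k, l)" for i j k l
  proof -
    have "3 * i + j \<noteq> 3 * k + l"
      using that by simp presburger
    then show ?thesis
      unfolding J_def using that len dist by (intro disjoint_nth_if_distinct_concat) simp_all
  qed
  have walk: "walk_edges vs \<subseteq> snd (prime_order_graph G)"
    if "distinct vs" "set vs \<subseteq> carrier G" "successively adj vs" for vs
    using that by (induction vs rule: walk_edges.induct) (auto simp: prime_order_graph_adjacent)
  show False
  proof (rule planar_imp_no_K33_subdivision[OF pl, of L "(!) xs" "(!) ys"])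
    fix i j :: nat assume ij: "i < 3" "j < 3"
    then have "i \<in> {0, 1, 2}" "j \<in> {0, 1, 2}"
      by auto
    then have "successively adj (L i j)"
      using adj unfolding L_def J_def by blast
    moreover have "distinct (L i j)"
      using JI(1)[OF ij] xJ[OF ij(1) ij] yJ[OF ij(2) ij] xy[OF ij] by (simp add: L_def)
    moreover have "set (L i j) \<subseteq> carrier G"
    proof -
      have "set (concat Is) \<subseteq> carrier G" "xs ! i \<in> carrier G" "ys ! j \<in> carrier G"
        using carr x(1)[OF ij(1)] y(1)[OF ij(2)] by auto
      with JI(2)[OF ij] have "set (J i j) \<subseteq> carrier G" "xs ! i \<in> carrier G" "ys ! j \<in> carrier G"
        by (meson subset_trans)+
      then show ?thesis
        unfolding L_def by simp
    qed
    ultimately show "walk_edges (L i j) \<subseteq> snd (prime_order_graph G) \<and> distinct (L i j) \<and>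
      2 \<le> length (L i j) \<and> set (L i j) \<subseteq> fst (prime_order_graph G) \<and> hd (L i j) = xs ! i \<and> last (L i j) = ys ! j"
      using walk[of "L i j"] by (simp add: L_def prime_order_graph_def)
  next
    fix i j k l :: nat assume *: "i < 3" "j < 3" "k < 3" "l < 3" "(i, j) \<noteq> (k, l)"
    have "insert u (insert v S) \<inter> insert u' (insert v' T) = (if u = u' then {u} else {}) \<union> (if v = v' then {v} else {})"
      if "u \<notin> T" "u' \<notin> S" "v \<notin> T" "v' \<notin> S" "u \<noteq> v'" "u' \<noteq> v" "S \<inter> T = {}" for u u' v v' :: 'a and S T
      using that by auto
    from this[OF xJ[OF *(1,3,4)] xJ[OF *(3,1,2)] yJ[OF *(2,3,4)] yJ[OF *(4,1,2)] xy[OF *(1,4)] xy[OF *(3,2)] JJ[OF *]]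
    have "set (L i j) \<inter> set (L k l) =
        (if xs ! i = xs ! k then {xs ! i} else {}) \<union> (if ys ! j = ys ! l then {ys ! j} else {})"
      by (simp add: L_def insert_commute)
    then show "set (L i j) \<inter> set (L k l) = (if i = k then {xs ! i} else if j = l then {ys ! j} else {})"
      unfolding x(2)[OF *(1) *(1,3)] y(2)[OF *(2) *(2,4)] using *(5) by (cases "i = k") simp_all
  qed
qed

lemma nonplanar_K33:
  assumes "distinct [x0, x1, x2, y0, y1, y2]" "{x0, x1, x2, y0, y1, y2} \<subseteq> carrier G"
    and "\<And>x y. x \<in> {x0, x1, x2} \<Longrightarrow> y \<in> {y0, y1, y2} \<Longrightarrow> adj x y"
  shows "\<not> planar (prime_order_graph G)"
  by (rule nonplanar_K33_subdivision[of "[x0, x1, x2]" "[y0, y1, y2]" "replicate 9 []"])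
    (use assms in \<open>simp_all add: numeral_eq_Suc\<close>)

section \<open>Prime orders and words in commuting elements\<close>

lemma ord_conjugate:
  assumes "g \<in> carrier G" "x \<in> carrier G"
  shows "ord (g \<otimes> x \<otimes> inv g) = ord x"
  using assms ord_mult_commute[of "g \<otimes> x" "inv g"] by (simp add: m_assoc[symmetric])

lemma ord_eq_primeI:
  assumes "x \<in> carrier G" "x \<noteq> \<one>" "prime q" "x [^] (q :: nat) = \<one>"
  shows "ord x = q"
  using assms by (metis ord_eq_1 pow_eq_id prime_nat_iff)

lemma commute_int_pow:
  assumes "x \<in> carrier G" "y \<in> carrier G" "x \<otimes> y = y \<otimes> x"
  shows "x \<otimes> y [^] (i :: int) = y [^] i \<otimes> x"
proof -
  have nat: "x \<otimes> y [^] n = y [^] n \<otimes> x" for n :: nat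
  proof (induction n)
    case (Suc n)
    have "x \<otimes> y [^] Suc n = (x \<otimes> y [^] n) \<otimes> y"
      using assms by (simp add: m_assoc)
    also have "\<dots> = y [^] n \<otimes> (x \<otimes> y)"
      using assms Suc by (simp add: m_assoc)
    also have "\<dots> = y [^] Suc n \<otimes> x"
      using assms by (simp add: m_assoc)
    finally show ?case .
  qed (use assms in simp)
  show ?thesis
  proof (cases i rule: int_cases2)
    case (nonneg n)
    then show ?thesis
      using nat by (simp add: int_pow_int)
  next
    case (nonpos n)
    then have "y [^] i = inv (y [^] n)"
      using assms by (simp add: int_pow_neg int_pow_int)
    then show ?thesis
      using nat[of n] assms by (metis inv_closed inv_solve_left inv_solve_right m_assoc m_closed nat_pow_closed)
  qed
qed

lemma int_pow_commute:
  assumes "x \<in> carrier G" "y \<in> carrier G" "x \<otimes> y = y \<otimes> x"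
  shows "x [^] (i :: int) \<otimes> y [^] (j :: int) = y [^] j \<otimes> x [^] i"
  using commute_int_pow[of "y [^] j" x i] commute_int_pow[of x y j] assms by simp

text \<open>Integer exponents turn multiplication into addition, so that products of vertices of a
  configuration are computed by arithmetic.\<close>

definition word :: "'a \<Rightarrow> 'a \<Rightarrow> 'a \<Rightarrow> int \<Rightarrow> int \<Rightarrow> int \<Rightarrow> 'a" where
  "word a b c i j k = a [^] i \<otimes> b [^] j \<otimes> c [^] k"

lemma word_closed [simp]:
  "a \<in> carrier G \<Longrightarrow> b \<in> carrier G \<Longrightarrow> c \<in> carrier G \<Longrightarrow> word a b c i j k \<in> carrier G"
  by (simp add: word_def)

text \<open>The three cyclic groups form an internal direct product. Taking \<open>\<one>\<close>
  for \<open>c\<close> gives the case of two generators, because its order 1 divides every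
  exponent.\<close>

definition independent :: "'a \<Rightarrow> 'a \<Rightarrow> 'a \<Rightarrow> bool" where
  "independent a b c \<longleftrightarrow> a \<in> carrier G \<and> b \<in> carrier G \<and> c \<in> carrier G \<and>
     a \<otimes> b = b \<otimes> a \<and> a \<otimes> c = c \<otimes> a \<and> b \<otimes> c = c \<otimes> b \<and>
     (\<forall>i j k. word a b c i j k = \<one> \<longrightarrow> int (ord a) dvd i \<and> int (ord b) dvd j \<and> int (ord c) dvd k)"

lemma word_mult:
  assumes "independent a b c"
  shows "word a b c i j k \<otimes> word a b c i' j' k' = word a b c (i + i') (j + j') (k + k')"
proof -
  have c: "a \<in> carrier G" "b \<in> carrier G" "c \<in> carrier G"
    and "a \<otimes> b = b \<otimes> a" "a \<otimes> c = c \<otimes> a" "b \<otimes> c = c \<otimes> b"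
    using assms by (auto simp: independent_def)
  then have comm: "b [^] j \<otimes> a [^] i' = a [^] i' \<otimes> b [^] j" "c [^] k \<otimes> a [^] i' = a [^] i' \<otimes> c [^] k"
    "c [^] k \<otimes> b [^] j' = b [^] j' \<otimes> c [^] k"
    using int_pow_commute by simp_all
  have "word a b c i j k \<otimes> word a b c i' j' k' = a [^] i \<otimes> b [^] j \<otimes> (c [^] k \<otimes> a [^] i') \<otimes> b [^] j' \<otimes> c [^] k'"
    using c by (simp add: word_def m_assoc)
  also have "\<dots> = a [^] i \<otimes> (b [^] j \<otimes> a [^] i') \<otimes> (c [^] k \<otimes> b [^] j') \<otimes> c [^] k'"
    unfolding comm(2) using c by (simp add: m_assoc)
  also have "\<dots> = (a [^] i \<otimes> a [^] i') \<otimes> (b [^] j \<otimes> b [^] j') \<otimes> (c [^] k \<otimes> c [^] k')"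
    unfolding comm(1,3) using c by (simp add: m_assoc)
  finally show ?thesis
    using c by (simp add: word_def int_pow_mult)
qed

lemma word_eq_one_iff:
  assumes "independent a b c"
  shows "word a b c i j k = \<one> \<longleftrightarrow> int (ord a) dvd i \<and> int (ord b) dvd j \<and> int (ord c) dvd k"
proof
  assume "int (ord a) dvd i \<and> int (ord b) dvd j \<and> int (ord c) dvd k"
  moreover have "a \<in> carrier G" "b \<in> carrier G" "c \<in> carrier G"
    using assms by (auto simp: independent_def)
  ultimately have "a [^] i = \<one>" "b [^] j = \<one>" "c [^] k = \<one>"
    using int_pow_eq_id by blast+
  then show "word a b c i j k = \<one>"
    by (simp add: word_def)
qed (use assms in \<open>auto simp: independent_def\<close>)

lemma word_eq_iff:
  assumes "independent a b c"
  shows "word a b c i j k = word a b c i' j' k' \<longleftrightarrow>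
    int (ord a) dvd i - i' \<and> int (ord b) dvd j - j' \<and> int (ord c) dvd k - k'"
proof -
  have "word a b c i j k = word a b c (i - i') (j - j') (k - k') \<otimes> word a b c i' j' k'"
    by (simp add: word_mult[OF assms])
  moreover have "word a b c l m n \<in> carrier G" for l m n
    using assms by (simp add: independent_def)
  ultimately show ?thesis
    using right_cancel[of "word a b c i' j' k'" "word a b c (i - i') (j - j') (k - k')" \<one>]
      word_eq_one_iff[OF assms, of "i - i'" "j - j'" "k - k'"] by simp
qed

lemma word_pow:
  assumes "independent a b c"
  shows "word a b c i j k [^] (n :: nat) = word a b c (int n * i) (int n * j) (int n * k)"
proof (induction n)
  case 0
  show ?case
    using word_eq_one_iff[OF assms, of 0 0 0] by simp
next
  case (Suc n)
  then show ?case
    by (simp add: word_mult[OF assms] algebra_simps)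
qed

lemma prime_ord_wordI:
  assumes "independent a b c" "prime q"
    and "int (ord a) dvd int q * i" "int (ord b) dvd int q * j" "int (ord c) dvd int q * k"
    and "\<not> (int (ord a) dvd i \<and> int (ord b) dvd j \<and> int (ord c) dvd k)"
  shows "prime (ord (word a b c i j k))"
proof -
  have "word a b c i j k \<in> carrier G" "word a b c i j k \<noteq> \<one>" "word a b c i j k [^] q = \<one>"
    using assms word_eq_one_iff[OF assms(1)] by (simp_all add: word_pow independent_def)
  then show ?thesis
    using ord_eq_primeI[of "word a b c i j k" q] assms(2) by simp
qed

lemma involution_pow:
  assumes "x \<in> carrier G" "ord x = 2"
  shows "x \<otimes> x = \<one>" "x [^] (i :: int) = (if even i then \<one> else x)"
proof -
  show "x \<otimes> x = \<one>"
    using pow_eq_id[of x 2] assms by (simp add: numeral_2_eq_2)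
  show "x [^] (i :: int) = (if even i then \<one> else x)"
  proof (cases "even i")
    case False
    then have "x [^] i = x [^] (1 :: int)"
      using assms int_pow_eq[of x i 1] by simp
    then show ?thesis
      using False assms by simp
  qed (use assms int_pow_eq_id[of x i] in simp)
qed

section \<open>Explicit subdivisions for particular generators\<close>

text \<open>A product of two different elements is an involution, so any six of the eight elements,
  split three against three, would do.\<close>

lemma nonplanar_elementary_abelian_8:
  assumes "independent a b c" "ord a = 2" "ord b = 2" "ord c = 2"
  shows "\<not> planar (prime_order_graph G)"
proof -
  define w where "w = word a b c"
  have ord: "prime (ord (w i j k))" if "\<not> (even i \<and> even j \<and> even k)" for i j k
    unfolding w_def using assms that by (intro prime_ord_wordI[of a b c 2]) auto
  have carr: "w i j k \<in> carrier G" for i j k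
    using assms by (simp add: w_def independent_def)
  note mult = word_mult[OF assms(1), folded w_def] 
  note eq = word_eq_iff[OF assms(1), folded w_def]
  show ?thesis
    by (rule nonplanar_K33[of "w 0 0 0" "w 1 0 0" "w 0 1 0" "w 1 1 0" "w 0 0 1" "w 1 0 1"])
      (use carr ord in \<open>auto simp: mult eq assms\<close>)
qed

text \<open>Here \<open>x \<otimes> y\<close> has order 3 unless \<open>y\<close> is the inverse of
  \<open>x\<close>. One side is the subgroup generated by \<open>a\<close>; being closed under
  inverses, it is joined to everything outside it.\<close>

lemma nonplanar_elementary_abelian_9:
  assumes "independent a b \<one>" "ord a = 3" "ord b = 3"
  shows "\<not> planar (prime_order_graph G)"
proof -
  define w where "w i j = word a b \<one> i j 0" for i j
  have ord: "prime (ord (w i j))" if "\<not> (3 dvd i \<and> 3 dvd j)" for i j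
    unfolding w_def using assms that by (intro prime_ord_wordI[of a b \<one> 3]) auto
  have carr: "w i j \<in> carrier G" for i j
    using assms by (simp add: w_def independent_def)
  have mult: "w i j \<otimes> w k l = w (i + k) (j + l)" for i j k l
    by (simp add: w_def word_mult[OF assms(1)])
  have eq: "w i j = w k l \<longleftrightarrow> 3 dvd i - k \<and> 3 dvd j - l" for i j k l
    by (simp add: w_def word_eq_iff[OF assms(1)] assms)
  show ?thesis
    by (rule nonplanar_K33[of "w 0 0" "w 1 0" "w (-1) 0" "w 0 1" "w 0 (-1)" "w 1 1"])
      (use carr ord in \<open>auto simp: mult eq assms\<close>)
qed

text \<open>The exponents 0, 1, -1 against 2, -2, 3 have non-zero sums between -3 and 4 and
  differences of absolute value at most 5. Order 5 is excluded only because there 3 and -2 give the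
  same element.\<close>

lemma nonplanar_prime_ge_7:
  assumes a: "a \<in> carrier G" "prime (ord a)" "7 \<le> ord a"
  shows "\<not> planar (prime_order_graph G)"
proof -
  have nd: "\<not> int (ord a) dvd k" if "k \<noteq> 0" "\<bar>k\<bar> < 7" for k
    using that a(3) dvd_imp_le_int[of k "int (ord a)"] by auto
  have ord: "prime (ord (a [^] k))" if "k \<noteq> 0" "\<bar>k\<bar> < 7" for k :: int
  proof -
    have "(a [^] k) [^] ord a = \<one>"
      using a(1) int_pow_eq_id[of a "k * int (ord a)"] int_pow_int[of G "a [^] k" "ord a"]
        int_pow_pow[of a k "int (ord a)"] by simp
    moreover have "a [^] k \<noteq> \<one>"
      using int_pow_eq_id[OF a(1)] nd[OF that] by simp
    ultimately show ?thesis
      using ord_eq_primeI[of "a [^] k" "ord a"] a by simp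
  qed
  define w where "w i = a [^] i" for i :: int
  have mult: "w i \<otimes> w j = w (i + j)" for i j
    by (simp add: w_def int_pow_mult a(1))
  have eq: "w i = w j \<longleftrightarrow> int (ord a) dvd j - i" for i j
    by (simp add: w_def int_pow_eq a(1))
  have ord': "k \<noteq> 0 \<Longrightarrow> \<bar>k\<bar> < 7 \<Longrightarrow> prime (ord (w k))" for k
    using ord by (simp add: w_def)
  have carr: "w i \<in> carrier G" for i
    using a by (simp add: w_def)
  show ?thesis
    by (rule nonplanar_K33[of "w 0" "w 1" "w (-1)" "w 2" "w (-2)" "w 3"])
      (use carr ord' nd a(3) in \<open>auto simp: mult eq\<close>)
qed

text \<open>In the dihedral group generated by \<open>s\<close> and \<open>t\<close>, a rotation
  times a reflection is a reflection, of order 2, so every rotation is joined to every reflection.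
  Non-commutation says that the rotation \<open>r\<close> differs from its inverse, which provides
  three rotations \<open>\<one>\<close>, \<open>r\<close>, \<open>r [^] 2\<close> and three
  reflections.\<close>

lemma nonplanar_dihedral:
  assumes s: "s \<in> carrier G" "ord s = 2" and t: "t \<in> carrier G" "ord t = 2" and "s \<otimes> t \<noteq> t \<otimes> s"
  shows "\<not> planar (prime_order_graph G)"
proof -
  define r where "r = s \<otimes> t"
  have r: "r \<in> carrier G"
    using s t by (simp add: r_def)
  have ss: "s \<otimes> s = \<one>" and tt: "t \<otimes> t = \<one>"
    using involution_pow(1) s t by simp_all
  have invs: "inv s = s" "inv t = t"
    using ss tt s t inv_equality by simp_all
  have "inv r = t \<otimes> s"
    using s t invs by (simp add: r_def inv_mult_group)
  then have rinv: "r \<noteq> inv r"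
    using assms(5) by (simp add: r_def)
  have srs: "s \<otimes> r = inv r \<otimes> s"
  proof -
    have "s \<otimes> r = t"
      using s t ss by (simp add: r_def m_assoc[symmetric])
    moreover have "inv r \<otimes> s = t"
      using s t ss \<open>inv r = t \<otimes> s\<close> by (simp add: m_assoc)
    ultimately show ?thesis by simp
  qed
  have flip: "s \<otimes> r [^] i = r [^] (- i) \<otimes> s" for i :: int
  proof -
    have step: "s \<otimes> r [^] n = inv r [^] n \<otimes> s" for n :: nat
    proof (induction n)
      case (Suc n)
      have "s \<otimes> r [^] Suc n = (s \<otimes> r [^] n) \<otimes> r"
        using s r by (simp add: m_assoc)
      also have "\<dots> = inv r [^] n \<otimes> (s \<otimes> r)"
        using s r Suc by (simp add: m_assoc)
      also have "\<dots> = inv r [^] Suc n \<otimes> s"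
        using s r srs by (simp add: m_assoc)
      finally show ?case .
    qed (use s in simp)
    show ?thesis
    proof (cases i rule: int_cases2)
      case (nonneg n)
      then show ?thesis
        using step[of n] r by (simp add: int_pow_int int_pow_neg nat_pow_inv)
    next
      case (nonpos n)
      have "r [^] n \<otimes> s = (s \<otimes> s) \<otimes> r [^] n \<otimes> s"
        using s r ss by simp
      also have "\<dots> = s \<otimes> (s \<otimes> r [^] n) \<otimes> s"
        using s r by (simp add: m_assoc)
      also have "\<dots> = s \<otimes> inv r [^] n \<otimes> (s \<otimes> s)"
        unfolding step using s r by (simp add: m_assoc)
      finally have "r [^] n \<otimes> s = s \<otimes> inv r [^] n"
        using s r ss by simp
      then show ?thesis
        using nonpos r by (simp add: int_pow_int int_pow_neg nat_pow_inv)
    qed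
  qed
  have s_not: "s \<noteq> r [^] i" for i :: int
  proof
    assume "s = r [^] i"
    then have "s \<otimes> r = r \<otimes> s"
      using r commute_int_pow[of r r i] by simp
    then show False
      using srs rinv r s by simp
  qed
  have refl: "ord (r [^] i \<otimes> s) = 2" for i :: int
  proof (rule ord_eq_primeI)
    have "(r [^] i \<otimes> s) \<otimes> (r [^] i \<otimes> s) = r [^] i \<otimes> (s \<otimes> r [^] i) \<otimes> s"
      using r s by (simp add: m_assoc)
    also have "\<dots> = (r [^] i \<otimes> r [^] (- i)) \<otimes> (s \<otimes> s)"
      unfolding flip using r s by (simp add: m_assoc)
    also have "\<dots> = \<one>"
      using r ss by (simp flip: int_pow_mult)
    finally show "(r [^] i \<otimes> s) [^] (2 :: nat) = \<one>"
      using r s by (simp add: numeral_2_eq_2)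
    show "r [^] i \<otimes> s \<noteq> \<one>"
    proof
      assume "r [^] i \<otimes> s = \<one>"
      then have "inv s = r [^] i"
        using r s by (simp add: inv_equality)
      then show False
        using s_not[of i] invs by simp
    qed
  qed (use r s in simp_all)
  have cross: "r [^] i \<noteq> r [^] j \<otimes> s" for i j :: int
  proof
    assume "r [^] i = r [^] j \<otimes> s"
    then have "s = r [^] (- j) \<otimes> r [^] i"
      using r s by (simp add: int_pow_neg m_assoc[symmetric])
    then show False
      using s_not[of "- j + i"] int_pow_mult[OF r, of "- j" i] by simp
  qed
  have dist: "r [^] (0::int) \<noteq> r [^] (1::int)" "r [^] (0::int) \<noteq> r [^] (2::int)" "r [^] (1::int) \<noteq> r [^] (2::int)"
  proof -
    have "r \<noteq> \<one>"
      using rinv by auto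
    moreover have "r \<otimes> r \<noteq> \<one>"
      using rinv r inv_equality by fastforce
    moreover have "r [^] (2::int) = r \<otimes> r"
      using r int_pow_mult[of r 1 1] by simp
    ultimately show "r [^] (0::int) \<noteq> r [^] (1::int)" "r [^] (0::int) \<noteq> r [^] (2::int)" "r [^] (1::int) \<noteq> r [^] (2::int)"
      using r by auto
  qed
  define u v where "u i = r [^] i" and "v i = r [^] i \<otimes> s" for i :: int
  have "u i \<noteq> v j" "v i = v j \<longleftrightarrow> u i = u j" for i j
    using cross s r by (simp_all add: u_def v_def)
  then have "distinct [u 0, u 1, u 2, v 0, v 1, v 2]"
    using dist[folded u_def] by simp
  moreover have "u i \<otimes> v j = v (i + j)" for i j
    using r s by (simp add: u_def v_def int_pow_mult m_assoc)
  moreover have "prime (ord (v i))" for i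
    using refl by (simp add: v_def)
  moreover have "u i \<in> carrier G" "v i \<in> carrier G" for i
    using r s by (simp_all add: u_def v_def)
  ultimately show ?thesis
    by (intro nonplanar_K33[of "u 0" "u 1" "u 2" "v 0" "v 1" "v 2"]) auto
qed

text \<open>Conjugation by \<open>a\<close> moves \<open>t\<close> to \<open>s\<close>,
  \<open>s\<close> to \<open>s \<otimes> t\<close> and \<open>s \<otimes> t\<close> back to
  \<open>t\<close>, so the group generated is alternating on four letters. Its elements outside the
  Klein four-group have order 3; hence the powers of \<open>a\<close> are joined to all three
  involutions.\<close>

lemma nonplanar_alternating_4:
  assumes a: "a \<in> carrier G" "ord a = 3" and t: "t \<in> carrier G" "ord t = 2"
    and s: "s = a \<otimes> t \<otimes> inv a" "s \<noteq> t" "s \<otimes> t = t \<otimes> s" and u: "a \<otimes> s \<otimes> inv a = s \<otimes> t"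
  shows "\<not> planar (prime_order_graph G)"
proof -
  have c: "s \<in> carrier G" "ord s = 2"
    using a t ord_conjugate by (simp_all add: s(1))
  have sq: "s \<otimes> s = \<one>" "t \<otimes> t = \<one>"
    using involution_pow(1) c t by simp_all
  define b where "b = inv a"
  have b: "b \<in> carrier G" "ord b = 3" "a \<otimes> b = \<one>" "b \<otimes> a = \<one>"
    using a by (simp_all add: b_def)
  have aaa: "a \<otimes> (a \<otimes> a) = \<one>"
    using pow_eq_id[of a 3] a by (simp add: numeral_3_eq_3 m_assoc)
  have bb: "b = a \<otimes> a"
    using inv_equality[of "a \<otimes> a" a] a aaa by (simp add: b_def m_assoc)
  have at: "a \<otimes> t = s \<otimes> a"
    using a t by (simp add: s(1) m_assoc)
  have as: "a \<otimes> s = s \<otimes> t \<otimes> a"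
  proof -
    have "a \<otimes> s = a \<otimes> s \<otimes> inv a \<otimes> a"
      using a c by (simp add: m_assoc)
    then show ?thesis by (simp add: u)
  qed
  have neq1: "s \<noteq> \<one>" "t \<noteq> \<one>" "s \<otimes> t \<noteq> \<one>"
    using c t s(2) ord_id sq inv_equality[of s t] inv_equality[of t t] by auto
  have ust: "s \<otimes> t \<noteq> s" "s \<otimes> t \<noteq> t"
    using neq1 c t by simp_all
  have u2: "ord (s \<otimes> t) = 2"
    using ord_conjugate[OF a(1) c(1)] c(2) by (simp add: u)
  define V where "V = {t, s, s \<otimes> t}"
  have V: "x \<in> carrier G" "ord x = 2" "x \<noteq> \<one>" if "x \<in> V" for x
  proof -
    have "x = t \<or> x = s \<or> x = s \<otimes> t"
      using that by (simp add: V_def)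
    then show "x \<in> carrier G" "ord x = 2" "x \<noteq> \<one>"
      using c t u2 neq1 m_closed[OF c(1) t(1)] by metis+
  qed
  have not_V: "a \<notin> V" "b \<notin> V" "\<one> \<notin> V"
    using V(2)[of a] V(2)[of b] V(3)[of \<one>] a(2) b(2) by auto
  have ax: "(a \<otimes> x) \<otimes> ((a \<otimes> x) \<otimes> (a \<otimes> x)) = \<one>" if "x \<in> V" for x
  proof -
    have V3: "a \<otimes> (s \<otimes> t) = t \<otimes> a"
    proof -
      have "a \<otimes> (s \<otimes> t) = (a \<otimes> s) \<otimes> t"
        using a c t by (simp add: m_assoc)
      also have "\<dots> = s \<otimes> t \<otimes> (a \<otimes> t)"
        unfolding as using a c t by (simp add: m_assoc)
      also have "\<dots> = (s \<otimes> (t \<otimes> s)) \<otimes> a"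
        unfolding at using a c t by (simp add: m_assoc)
      also have "\<dots> = ((s \<otimes> s) \<otimes> t) \<otimes> a"
        unfolding s(3)[symmetric] using a c t by (simp add: m_assoc)
      finally show ?thesis
        using sq t by simp
    qed
    \<comment> \<open>With \<open>x\<close>, \<open>y\<close>, \<open>z\<close> the orbit under
      conjugation by \<open>a\<close>, the three factors \<open>a\<close> are moved to the right and
      cancel; what remains is the product of the three involutions, which is trivial.\<close>
    have prod: "(a \<otimes> x) \<otimes> ((a \<otimes> x) \<otimes> (a \<otimes> x)) = y \<otimes> z \<otimes> x"
      if "x \<in> carrier G" "y \<in> carrier G" "z \<in> carrier G" "a \<otimes> x = y \<otimes> a" "a \<otimes> y = z \<otimes> a" "a \<otimes> z = x \<otimes> a" for x y z
    proof -
      have "(a \<otimes> x) \<otimes> ((a \<otimes> x) \<otimes> (a \<otimes> x)) = (y \<otimes> a) \<otimes> ((y \<otimes> a) \<otimes> (y \<otimes> a))"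
        by (simp only: that(4))
      also have "\<dots> = y \<otimes> ((a \<otimes> y) \<otimes> ((a \<otimes> y) \<otimes> a))"
        using that(1-3) a by (simp add: m_assoc)
      also have "\<dots> = y \<otimes> ((z \<otimes> a) \<otimes> ((z \<otimes> a) \<otimes> a))"
        by (simp only: that(5))
      also have "\<dots> = y \<otimes> (z \<otimes> ((a \<otimes> z) \<otimes> (a \<otimes> a)))"
        using that(1-3) a by (simp add: m_assoc)
      also have "\<dots> = y \<otimes> (z \<otimes> (x \<otimes> (a \<otimes> (a \<otimes> a))))"
        unfolding that(6) using that(1-3) a by (simp add: m_assoc)
      finally show ?thesis
        using that(1-3) aaa by (simp add: m_assoc)
    qed
    have st: "s \<otimes> t \<in> carrier G"
      using c t by simp
    consider "x = t" | "x = s" | "x = s \<otimes> t"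
      using \<open>x \<in> V\<close> by (auto simp: V_def)
    then show ?thesis
    proof cases
      case 1
      have "s \<otimes> (s \<otimes> t) \<otimes> t = (s \<otimes> s) \<otimes> (t \<otimes> t)"
        using c t by (simp add: m_assoc)
      then show ?thesis
        using prod[OF t(1) c(1) st at as V3] 1 sq by simp
    next
      case 2
      have "(s \<otimes> t) \<otimes> t \<otimes> s = s \<otimes> (t \<otimes> t) \<otimes> s"
        using c t by (simp add: m_assoc)
      then show ?thesis
        using prod[OF c(1) st t(1) as V3 at] 2 sq c by simp
    next
      case 3
      have "t \<otimes> s \<otimes> (s \<otimes> t) = t \<otimes> (s \<otimes> s) \<otimes> t"
        using c t by (simp add: m_assoc)
      then show ?thesis
        using prod[OF st t(1) c(1) V3 at as] 3 sq t by simp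
    qed
  qed
  have ord_ax: "ord (a \<otimes> x) = 3" if "x \<in> V" for x
  proof (rule ord_eq_primeI)
    show "(a \<otimes> x) [^] (3::nat) = \<one>"
      using ax[OF that] V(1)[OF that] a by (simp add: numeral_3_eq_3 m_assoc)
    show "a \<otimes> x \<noteq> \<one>"
    proof
      assume "a \<otimes> x = \<one>"
      then have "inv x = a"
        using V(1)[OF that] a inv_equality by blast
      then show False
        using V[OF that] a ord_inv[of x] by simp
    qed
  qed (use V(1)[OF that] a in simp_all)
  have ord_bx: "ord (b \<otimes> x) = 3" if "x \<in> V" for x
  proof -
    have "inv x = x"
      using V[OF that] involution_pow(1) inv_equality by blast
    then have "b \<otimes> x = inv (x \<otimes> a)"
      using V(1)[OF that] a by (simp add: b_def inv_mult_group)
    then show ?thesis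
      using ord_ax[OF that] ord_mult_commute[of a x] V(1)[OF that] a by simp
  qed
  have ne: "a \<noteq> \<one>" "b \<noteq> \<one>" "a \<noteq> b"
  proof -
    show "a \<noteq> \<one>" "b \<noteq> \<one>"
      using a b by auto
    then show "a \<noteq> b"
      using bb a by (metis r_cancel_one')
  qed
  show ?thesis
  proof (rule nonplanar_K33)
    have "t \<noteq> s" "t \<noteq> s \<otimes> t" "s \<noteq> s \<otimes> t"
      using ust s(2) by metis+
    then show "distinct [\<one>, a, b, t, s, s \<otimes> t]"
      using not_V ne unfolding V_def by simp
    show "{\<one>, a, b, t, s, s \<otimes> t} \<subseteq> carrier G"
      using a(1) b(1) c(1) t(1) by simp
    fix x y assume "x \<in> {\<one>, a, b}" "y \<in> {t, s, s \<otimes> t}"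
    then have "y \<in> V" "x = \<one> \<or> x = a \<or> x = b"
      by (simp_all add: V_def)
    then have "ord (x \<otimes> y) = 2 \<or> ord (x \<otimes> y) = 3"
      using V(1,2)[of y] ord_ax[of y] ord_bx[of y] by (metis l_one)
    then show "prime (ord (x \<otimes> y))"
      by (elim disjE) simp_all
  qed
qed

text \<open>
  \<open>A i = x \<otimes> a [^] i\<close> and \<open>B j = a [^] j \<otimes> inv x\<close> are adjacent unless \<open>5 dvd i + j\<close>; among the chosen
  branch vertices only the edge from \<open>A 1\<close> to \<open>B 4\<close> is missing, and it is replaced by a path.
\<close>

lemma nonplanar_ord_5_coset:
  assumes a: "a \<in> carrier G" "ord a = 5" and x: "x \<in> carrier G"
    and disj: "\<And>(i::int) (j::int). x \<otimes> a [^] i \<noteq> a [^] j \<otimes> inv x"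
  shows "\<not> planar (prime_order_graph G)"
proof -
  define A B where "A i = x \<otimes> a [^] i" and "B j = a [^] j \<otimes> inv x" for i j :: int
  have carr: "A i \<in> carrier G" "B i \<in> carrier G" for i
    using a x by (simp_all add: A_def B_def)
  have eqA: "A i = A j \<longleftrightarrow> 5 dvd j - i" for i j
    using a x int_pow_eq[of a i j] by (simp add: A_def)
  have eqB: "B i = B j \<longleftrightarrow> 5 dvd j - i" for i j
    using a x int_pow_eq[of a i j] by (simp add: B_def)
  have AB: "A i \<noteq> B j" "B j \<noteq> A i" for i j
    using disj[of i j] by (auto simp: A_def B_def)
  have ord: "prime (ord (a [^] k))" if "\<not> 5 dvd k" for k :: int
  proof -
    have "(a [^] k) [^] (5 :: nat) = a [^] (k * 5)"
      using a(1) int_pow_pow[of a k 5] int_pow_int[of G "a [^] k" 5] by simp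
    also have "\<dots> = \<one>"
      using a int_pow_eq_id[of a "k * 5"] by simp
    finally show ?thesis
      using ord_eq_primeI[of "a [^] k" 5] a int_pow_eq_id[of a k] that by simp
  qed
  have adjAB: "prime (ord (A i \<otimes> B j))" if "\<not> 5 dvd i + j" for i j
  proof -
    have "A i \<otimes> B j = x \<otimes> (a [^] i \<otimes> a [^] j) \<otimes> inv x"
      using a x by (simp add: A_def B_def m_assoc)
    also have "\<dots> = x \<otimes> a [^] (i + j) \<otimes> inv x"
      using a by (simp add: int_pow_mult)
    finally show ?thesis
      using ord_conjugate[OF x, of "a [^] (i + j)"] a ord[OF that] by simp
  qed
  then have adjBA: "prime (ord (B i \<otimes> A j))" if "\<not> 5 dvd i + j" for i j
    using that carr ord_mult_commute[of "A j" "B i"] by (metis add.commute)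
  show ?thesis
    by (rule nonplanar_K33_subdivision[of "[A 1, A 2, A 3]" "[B 0, B 1, B 4]"
          "[[], [], [B 2, A 4], [], [], [], [], [], []]"])
      (use carr AB adjAB adjBA in \<open>auto simp: eqA eqB\<close>)
qed

text \<open>The powers of \<open>a\<close> supply five branch vertices and \<open>s\<close> is the
  sixth. Only the edges from \<open>w 0 1\<close> and \<open>w 0 (-1)\<close> to \<open>s\<close>
  are missing, their products having order 10; the detour through \<open>w 1 (-1)\<close> or
  \<open>w 1 1\<close> has product \<open>s\<close> on its first edge and a power of
  \<open>a\<close> on its second.\<close>

lemma nonplanar_cyclic_10:
  assumes "independent s a \<one>" "ord s = 2" "ord a = 5"
  shows "\<not> planar (prime_order_graph G)"
proof -
  define w where "w i j = word s a \<one> i j 0" for i j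
  have ord2: "prime (ord (w i j))" if "odd i" "5 dvd j" for i j
    unfolding w_def using assms that by (intro prime_ord_wordI[of s a \<one> 2]) auto
  have ord5: "prime (ord (w i j))" if "even i" "\<not> 5 dvd j" for i j
    unfolding w_def using assms that by (intro prime_ord_wordI[of s a \<one> 5]) auto
  have carr: "w i j \<in> carrier G" for i j
    using assms by (simp add: w_def independent_def)
  have mult: "w i j \<otimes> w k l = w (i + k) (j + l)" for i j k l
    by (simp add: w_def word_mult[OF assms(1)])
  have eq: "w i j = w k l \<longleftrightarrow> even (i - k) \<and> 5 dvd j - l" for i j k l
    by (simp add: w_def word_eq_iff[OF assms(1)] assms)
  show ?thesis
    by (rule nonplanar_K33_subdivision[of "[w 0 0, w 0 1, w 0 (-1)]" "[w 0 2, w 0 (-2), w 1 0]"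
          "[[], [], [], [], [], [w 1 (-1)], [], [], [w 1 1]]"])
      (use carr ord2 ord5 in \<open>auto simp: mult eq\<close>)
qed

text \<open>Two elements are joined when their product is non-trivial in exactly one of the Klein
  and the order 3 component. Elements with last exponent 1 are therefore joined to those with last
  exponent -1 and a different Klein part; the one bad pair, \<open>w 0 0 1\<close> and
  \<open>w 0 0 (-1)\<close>, is bypassed among such elements. The branch vertex
  \<open>w 1 1 0\<close> is reached from \<open>w i j 1\<close> through \<open>w i j 0\<close>,
  where the first product is \<open>a\<close> and the second lies in the Klein group.\<close>

lemma nonplanar_klein_times_3:
  assumes "independent t s a" "ord t = 2" "ord s = 2" "ord a = 3"
  shows "\<not> planar (prime_order_graph G)"
proof -
  define w where "w = word t s a"
  have ord2: "prime (ord (w i j k))" if "\<not> (even i \<and> even j)" "3 dvd k" for i j k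
    unfolding w_def using assms that by (intro prime_ord_wordI[of t s a 2]) auto
  have ord3: "prime (ord (w i j k))" if "even i" "even j" "\<not> 3 dvd k" for i j k
    unfolding w_def using assms that by (intro prime_ord_wordI[of t s a 3]) auto
  have carr: "w i j k \<in> carrier G" for i j k
    using assms by (simp add: w_def independent_def)
  note mult = word_mult[OF assms(1), folded w_def]
  note eq = word_eq_iff[OF assms(1), folded w_def, unfolded assms(2-4)]
  show ?thesis
    by (rule nonplanar_K33_subdivision[of "[w 0 0 1, w 1 0 1, w 0 1 1]" "[w 1 1 (-1), w 1 1 0, w 0 0 (-1)]"
          "[[], [w 0 0 0], [w 1 0 (-1), w 1 1 1], [], [w 1 0 0], [], [], [w 0 1 0], []]"])
      (use carr ord2 ord3 in \<open>auto simp: mult eq\<close>)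
qed

section \<open>Two non-commuting elements of order 3\<close>

lemma commute_inv:
  assumes "x \<in> carrier G" "y \<in> carrier G" "x \<otimes> y = y \<otimes> x"
  shows "x \<otimes> inv y = inv y \<otimes> x"
  using commute_int_pow[OF assms, of "-1"] assms by (simp add: int_pow_neg)

lemma commute_mult_iff:
  assumes "x \<in> carrier G" "y \<in> carrier G" "x \<otimes> y = y \<otimes> x" "z \<in> carrier G"
  shows "x \<otimes> (y \<otimes> z) = (y \<otimes> z) \<otimes> x \<longleftrightarrow> x \<otimes> z = z \<otimes> x"
    and "x \<otimes> (z \<otimes> y) = (z \<otimes> y) \<otimes> x \<longleftrightarrow> x \<otimes> z = z \<otimes> x"
proof -
  have "x \<otimes> (y \<otimes> z) = y \<otimes> (x \<otimes> z)"
    using assms by (simp add: m_assoc[symmetric])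
  moreover have "(y \<otimes> z) \<otimes> x = y \<otimes> (z \<otimes> x)"
    using assms by (simp add: m_assoc)
  ultimately show "x \<otimes> (y \<otimes> z) = (y \<otimes> z) \<otimes> x \<longleftrightarrow> x \<otimes> z = z \<otimes> x"
    using assms by simp
  have "x \<otimes> (z \<otimes> y) = (x \<otimes> z) \<otimes> y"
    using assms by (simp add: m_assoc)
  moreover have "(z \<otimes> y) \<otimes> x = (z \<otimes> x) \<otimes> y"
    using assms(1,2,4) by (simp add: m_assoc assms(3))
  ultimately show "x \<otimes> (z \<otimes> y) = (z \<otimes> y) \<otimes> x \<longleftrightarrow> x \<otimes> z = z \<otimes> x"
    using assms by simp
qed

text \<open>Conjugation by \<open>b\<close> would invert \<open>a\<close>; its cube would invert
  \<open>a\<close> as well, yet is trivial because the cube of \<open>b\<close> is. This rules out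
  coincidences such as \<open>B \<otimes> a = A \<otimes> B\<close> between vertices of the next
  configuration.\<close>

lemma order_3_not_inverted:
  assumes "a \<in> carrier G" "ord a = 3" "b \<in> carrier G" "ord b = 3"
  shows "b \<otimes> a \<noteq> inv a \<otimes> b"
proof
  assume eq: "b \<otimes> a = inv a \<otimes> b"
  have eq': "b \<otimes> inv a = a \<otimes> b"
  proof -
    have "b \<otimes> inv a = a \<otimes> (inv a \<otimes> b) \<otimes> inv a"
      using assms by (simp add: m_assoc[symmetric])
    also have "\<dots> = a \<otimes> b"
      unfolding eq[symmetric] using assms by (simp add: m_assoc)
    finally show ?thesis .
  qed
  have bbb: "b \<otimes> (b \<otimes> b) = \<one>"
    using pow_eq_id[of b 3] assms by (simp add: numeral_3_eq_3 m_assoc)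
  have "b \<otimes> (b \<otimes> (b \<otimes> a)) = b \<otimes> ((b \<otimes> inv a) \<otimes> b)"
    unfolding eq using assms by (simp add: m_assoc)
  also have "\<dots> = (b \<otimes> a) \<otimes> (b \<otimes> b)"
    unfolding eq' using assms by (simp add: m_assoc)
  also have "\<dots> = inv a \<otimes> (b \<otimes> (b \<otimes> b))"
    unfolding eq using assms by (simp add: m_assoc)
  finally have "(b \<otimes> (b \<otimes> b)) \<otimes> a = inv a \<otimes> (b \<otimes> (b \<otimes> b))"
    using assms by (simp add: m_assoc)
  then have "a = inv a"
    using assms bbb by simp
  then have "a \<otimes> a = \<one>"
    using assms by (metis r_inv)
  then have "3 dvd (2 :: nat)"
    using assms pow_eq_id[of a 2] by (simp add: numeral_2_eq_2)
  then show False
    by simp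
qed

text \<open>All products used collapse to conjugates or powers of \<open>a\<close> or
  \<open>b\<close>. The orders of \<open>a \<otimes> (B \<otimes> a)\<close> and
  \<open>a \<otimes> (a \<otimes> B)\<close> are not controlled, so these two edges are replaced by
  paths through \<open>A \<otimes> B\<close> and \<open>B \<otimes> A\<close>.\<close>

lemma nonplanar_noncommuting_order_3:
  assumes a: "a \<in> carrier G" "ord a = 3" and b: "b \<in> carrier G" "ord b = 3" and nc: "a \<otimes> b \<noteq> b \<otimes> a"
  shows "\<not> planar (prime_order_graph G)"
proof -
  define A B where "A = inv a" and "B = inv b"
  have AB: "A \<in> carrier G" "B \<in> carrier G" "ord A = 3" "ord B = 3" "inv A = a" "inv B = b"
    using a b by (simp_all add: A_def B_def)
  have canc: "a \<otimes> A = \<one>" "A \<otimes> a = \<one>" "b \<otimes> B = \<one>" "B \<otimes> b = \<one>"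
    using a b by (simp_all add: A_def B_def)
  have BB: "B \<otimes> B = b"
  proof -
    have "b \<otimes> b \<otimes> b = \<one>"
      using pow_eq_id[of b 3] b by (simp add: numeral_3_eq_3)
    then have "B = b \<otimes> b"
      using b inv_equality[of "b \<otimes> b" b] by (simp add: B_def)
    moreover have "inv (b \<otimes> b) = B \<otimes> B"
      using b by (simp add: B_def inv_mult_group)
    ultimately show ?thesis
      using AB(6) by simp
  qed
  have nc1: "B \<otimes> a \<noteq> a \<otimes> B" "A \<otimes> b \<noteq> b \<otimes> A" "A \<otimes> B \<noteq> B \<otimes> A"
  proof -
    show *: "B \<otimes> a \<noteq> a \<otimes> B"
      using nc commute_inv[of a B] a AB by auto
    show "A \<otimes> b \<noteq> b \<otimes> A"
      using nc commute_inv[of b A] b AB by auto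
    show "A \<otimes> B \<noteq> B \<otimes> A"
      using * commute_inv[of B A] AB by auto
  qed
  note carr = a(1) b(1) AB(1,2)
  \<comment> \<open>The four mixed products commute neither with \<open>a\<close> nor with
    \<open>b\<close>, whereas each of \<open>a\<close>, \<open>A\<close>, \<open>\<one>\<close>,
    \<open>b\<close> commutes with one of these.\<close>
  have C: "x \<notin> {a, A, \<one>, b}" if "x \<in> {B \<otimes> a, a \<otimes> B, A \<otimes> B, B \<otimes> A}" for x
  proof -
    have x: "x = B \<otimes> a \<or> x = a \<otimes> B \<or> x = A \<otimes> B \<or> x = B \<otimes> A"
      using that by simp
    have aB: "a \<otimes> B \<noteq> B \<otimes> a" and bA: "b \<otimes> A \<noteq> A \<otimes> b"
      using nc1 by metis+
    have "a \<otimes> (B \<otimes> a) \<noteq> (B \<otimes> a) \<otimes> a" "a \<otimes> (a \<otimes> B) \<noteq> (a \<otimes> B) \<otimes> a"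
      "a \<otimes> (A \<otimes> B) \<noteq> (A \<otimes> B) \<otimes> a" "a \<otimes> (B \<otimes> A) \<noteq> (B \<otimes> A) \<otimes> a"
      using aB bA nc canc commute_mult_iff[of a a B] commute_mult_iff[of a A B] carr by auto
    then have "a \<otimes> x \<noteq> x \<otimes> a"
      using x by metis
    moreover have "b \<otimes> (B \<otimes> a) \<noteq> (B \<otimes> a) \<otimes> b" "b \<otimes> (a \<otimes> B) \<noteq> (a \<otimes> B) \<otimes> b"
      "b \<otimes> (A \<otimes> B) \<noteq> (A \<otimes> B) \<otimes> b" "b \<otimes> (B \<otimes> A) \<noteq> (B \<otimes> A) \<otimes> b"
      using aB bA nc canc commute_mult_iff[of b B a] commute_mult_iff[of b B A] nc carr by auto
    then have "b \<otimes> x \<noteq> x \<otimes> b"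
      using x by metis
    moreover have "a \<otimes> A = A \<otimes> a"
      using canc by simp
    ultimately show ?thesis
      using carr by (metis empty_iff insert_iff l_one r_one)
  qed
  have ne: "a \<noteq> \<one>" "b \<noteq> \<one>" "A \<noteq> \<one>" "a \<noteq> A" "a \<noteq> b" "A \<noteq> b"
  proof -
    show "a \<noteq> \<one>" "b \<noteq> \<one>" "A \<noteq> \<one>"
      using a(2) b(2) AB(3) by auto
    show "a \<noteq> b" "A \<noteq> b"
      using nc nc1(2) by auto
    show "a \<noteq> A"
    proof
      assume "a = A"
      then have "a [^] (2::nat) = \<one>"
        using canc(1) a(1) by (simp add: numeral_2_eq_2)
      then show False
        using pow_eq_id[of a 2] a by simp
    qed
  qed
  have ne2: "B \<otimes> a \<noteq> A \<otimes> B" "a \<otimes> B \<noteq> B \<otimes> A" "B \<otimes> a \<noteq> B \<otimes> A" "a \<otimes> B \<noteq> A \<otimes> B"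
  proof -
    show "B \<otimes> a \<noteq> A \<otimes> B"
      using order_3_not_inverted[of a B] a AB by (simp add: A_def)
    show "a \<otimes> B \<noteq> B \<otimes> A"
      using order_3_not_inverted[of A B] AB by auto
  qed (use ne(4) carr in simp_all)
  have adj: "adj a \<one>" "adj A \<one>" "adj b \<one>"
    using a b AB by simp_all
  have adj1: "adj A (a \<otimes> B)" "adj a (A \<otimes> B)" "adj b (B \<otimes> a)" "adj (B \<otimes> A) (a \<otimes> B)"
  proof -
    have "A \<otimes> (a \<otimes> B) = B" "a \<otimes> (A \<otimes> B) = B" "b \<otimes> (B \<otimes> a) = a"
      using carr canc by (simp_all add: m_assoc[symmetric])
    moreover have "(B \<otimes> A) \<otimes> (a \<otimes> B) = b"
    proof -
      have "(B \<otimes> A) \<otimes> (a \<otimes> B) = B \<otimes> (A \<otimes> a) \<otimes> B"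
        using carr by (simp add: m_assoc)
      then show ?thesis
        using canc BB carr by simp
    qed
    ultimately show "adj A (a \<otimes> B)" "adj a (A \<otimes> B)" "adj b (B \<otimes> a)" "adj (B \<otimes> A) (a \<otimes> B)"
      using a b AB by simp_all
  qed
  have adj2: "adj A (B \<otimes> a)" "adj b (a \<otimes> B)" "adj a (B \<otimes> A)" "adj (A \<otimes> B) (B \<otimes> a)"
  proof -
    have "ord (A \<otimes> (B \<otimes> a)) = 3" "ord (b \<otimes> (a \<otimes> B)) = 3" "ord (a \<otimes> (B \<otimes> A)) = 3"
      using ord_conjugate[of A B] ord_conjugate[of b a] ord_conjugate[of a B] a b AB
      by (simp_all add: m_assoc A_def[symmetric] B_def[symmetric])
    moreover have "ord ((A \<otimes> B) \<otimes> (B \<otimes> a)) = 3"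
    proof -
      have "(A \<otimes> B) \<otimes> (B \<otimes> a) = A \<otimes> b \<otimes> inv A"
        unfolding BB[symmetric] AB(5) using carr by (simp add: m_assoc)
      then show ?thesis
        using ord_conjugate[of A b] carr b by simp
    qed
    ultimately show "adj A (B \<otimes> a)" "adj b (a \<otimes> B)" "adj a (B \<otimes> A)" "adj (A \<otimes> B) (B \<otimes> a)"
      by simp_all
  qed
  show ?thesis
  proof (rule nonplanar_K33_subdivision[of "[a, A, b]" "[\<one>, B \<otimes> a, a \<otimes> B]"
        "[[], [A \<otimes> B], [B \<otimes> A], [], [], [], [], [], []]"])
    show "distinct ([a, A, b] @ [\<one>, B \<otimes> a, a \<otimes> B] @ concat [[], [A \<otimes> B], [B \<otimes> A], [], [], [], [], [], []])"
      using C[of "B \<otimes> a"] C[of "a \<otimes> B"] C[of "A \<otimes> B"] C[of "B \<otimes> A"] ne ne2 nc1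
      by (simp only: concat.simps append.simps distinct.simps list.set insert_iff empty_iff simp_thms) metis
  qed (use carr adj adj1 adj2 in simp_all)
qed

section \<open>Groups with planar prime order element graph\<close>

text \<open>Commuting elements of order 3 that are neither equal nor inverse to each other span a
  direct product of order 9. Reducing exponents modulo 3 by \<open>pow3\<close> leaves finitely many
  relations to exclude.\<close>

lemma planar_imp_order_3_eq:
  assumes "planar (prime_order_graph G)"
    and a: "a \<in> carrier G" "ord a = 3" and b: "b \<in> carrier G" "ord b = 3"
  shows "b = a \<or> b = inv a"
proof (rule ccontr)
  assume ne: "\<not> ?thesis"
  have comm: "a \<otimes> b = b \<otimes> a"
    using nonplanar_noncommuting_order_3[OF a b] assms(1) by blast
  have pow3: "x [^] i = (if 3 dvd i then \<one> else if 3 dvd i - 1 then x else inv x)"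
    if "x \<in> carrier G" "ord x = 3" for x and i :: int
  proof -
    have "3 dvd i \<or> 3 dvd i - 1 \<or> 3 dvd i + 1"
      by presburger
    then have "3 dvd i \<or> 3 dvd 1 - i \<or> 3 dvd -1 - i"
      by presburger
    then have "x [^] i = \<one> \<and> 3 dvd i \<or> x [^] i = x \<and> 3 dvd i - 1 \<or> x [^] i = inv x \<and> 3 dvd i + 1"
      using that int_pow_eq_id[of x i] int_pow_eq[of x i 1] int_pow_eq[of x i "-1"]
      by (auto simp: int_pow_neg dvd_diff_commute)
    then show ?thesis
      by auto presburger+
  qed
  have "3 dvd i \<and> 3 dvd j" if "a [^] i \<otimes> b [^] j = \<one>" for i j :: int
  proof -
    have "b [^] j = inv (a [^] i)"
      using that a b by (metis int_pow_closed inv_equality inv_inv)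
    moreover have "a \<noteq> \<one>" "b \<noteq> \<one>" "inv a \<noteq> \<one>" "inv b \<noteq> \<one>"
      using a b ord_inv[of a] ord_inv[of b] by auto
    moreover from this have "\<one> \<noteq> inv a" "\<one> \<noteq> inv b"
      by metis+
    ultimately show ?thesis
      using ne a b unfolding pow3[OF a] pow3[OF b] by (auto split: if_splits)
  qed
  then have "independent a b \<one>"
    using a b comm by (simp add: independent_def word_def)
  then show False
    using nonplanar_elementary_abelian_9[of a b] a b assms(1) by blast
qed

lemma planar_imp_involutions_commute:
  assumes "planar (prime_order_graph G)" "s \<in> carrier G" "ord s = 2" "t \<in> carrier G" "ord t = 2"
  shows "s \<otimes> t = t \<otimes> s"
  using nonplanar_dihedral assms by blast

text \<open>Any further involution would generate with \<open>s\<close> and \<open>t\<close> an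
  elementary abelian group of order 8.\<close>

lemma planar_imp_third_involution:
  assumes pl: "planar (prime_order_graph G)"
    and s: "s \<in> carrier G" "ord s = 2" and t: "t \<in> carrier G" "ord t = 2" and "s \<noteq> t"
    and u: "u \<in> carrier G" "ord u = 2" "u \<noteq> s" "u \<noteq> t"
  shows "u = s \<otimes> t"
proof (rule ccontr)
  assume ne: "u \<noteq> s \<otimes> t"
  note comm = planar_imp_involutions_commute[OF pl]
  have invs: "inv s = s" "inv t = t" "inv u = u"
    using involution_pow(1) inv_equality s t u by blast+
  have ne1: "s \<noteq> \<one>" "t \<noteq> \<one>" "u \<noteq> \<one>"
    using s t u by auto
  have prod: "x \<otimes> y \<noteq> \<one>" if "x \<in> carrier G" "y \<in> carrier G" "inv y = y" "x \<noteq> y" for x y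
    using that inv_equality by metis
  have "even i \<and> even j \<and> even k" if "s [^] i \<otimes> t [^] j \<otimes> u [^] k = \<one>" for i j k :: int
  proof -
    have "s \<otimes> t \<noteq> \<one>" "s \<otimes> u \<noteq> \<one>" "t \<otimes> u \<noteq> \<one>" "s \<otimes> t \<otimes> u \<noteq> \<one>"
      using s t u invs assms(6) ne by (intro prod; simp)+
    then show ?thesis
      using that ne1 s t u unfolding involution_pow(2)[OF s] involution_pow(2)[OF t] involution_pow(2)[OF u(1,2)]
      by (auto split: if_splits)
  qed
  then have "independent s t u"
    using s t u comm by (simp add: independent_def word_def)
  then show False
    using nonplanar_elementary_abelian_8 s t u pl by blast
qed

text \<open>Exactly two is impossible: different involutions commute, so their product is a third
  one, and then there is no fourth.\<close>

lemma card_involutions: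
  assumes pl: "planar (prime_order_graph G)" and "s \<in> carrier G" "ord s = 2"
  shows "card {x \<in> carrier G. ord x = 2} = 1 \<or> card {x \<in> carrier G. ord x = 2} = 3"
proof (cases "\<exists>t \<in> carrier G. ord t = 2 \<and> t \<noteq> s")
  case False
  then have "{x \<in> carrier G. ord x = 2} = {s}"
    using assms(2,3) by blast
  then show ?thesis
    by simp
next
  case True
  then obtain t where t: "t \<in> carrier G" "ord t = 2" "t \<noteq> s"
    by blast
  have sq: "s \<otimes> s = \<one>" "t \<otimes> t = \<one>"
    using involution_pow(1) assms t by simp_all
  have comm: "s \<otimes> t = t \<otimes> s"
    using planar_imp_involutions_commute[OF pl assms(2,3) t(1,2)] .
  have "ord (s \<otimes> t) = 2"
  proof (rule ord_eq_primeI)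
    have "(s \<otimes> t) \<otimes> (s \<otimes> t) = s \<otimes> (t \<otimes> s) \<otimes> t"
      using assms t by (simp add: m_assoc)
    also have "\<dots> = (s \<otimes> s) \<otimes> (t \<otimes> t)"
      unfolding comm[symmetric] using assms t by (simp add: m_assoc)
    finally show "(s \<otimes> t) [^] (2::nat) = \<one>"
      using assms t sq by (simp add: numeral_2_eq_2)
    show "s \<otimes> t \<noteq> \<one>"
      using t assms sq inv_equality by metis
  qed (use assms t in simp_all)
  moreover have "s \<otimes> t \<noteq> s" "s \<otimes> t \<noteq> t"
    using assms t by auto
  moreover have "s \<otimes> t \<in> carrier G"
    using assms t by simp
  ultimately have "{x \<in> carrier G. ord x = 2} = {s, t, s \<otimes> t}"
    using planar_imp_third_involution[OF pl assms(2,3) t(1,2)] t assms(2,3) by blast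
  moreover have "card {s, t, s \<otimes> t} = 3"
    using t(3) \<open>s \<otimes> t \<noteq> s\<close> \<open>s \<otimes> t \<noteq> t\<close> by (subst card_insert_disjoint; force)+
  ultimately show ?thesis
    by simp
qed

text \<open>Conjugation by \<open>a\<close> permutes the involutions, of which there are at most three.\<close>

lemma planar_imp_commute_pow:
  assumes pl: "planar (prime_order_graph G)" and s: "s \<in> carrier G" "ord s = 2" and a: "a \<in> carrier G"
    and neq: "a \<otimes> s \<noteq> s \<otimes> a"
  shows "(a \<otimes> a) \<otimes> s = s \<otimes> (a \<otimes> a) \<or>
    a \<otimes> (a \<otimes> s \<otimes> inv a) \<otimes> inv a = a \<otimes> s \<otimes> inv a \<otimes> s"
proof -
  define c d where "c = a \<otimes> s \<otimes> inv a" and "d = a \<otimes> c \<otimes> inv a"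
  have c: "c \<in> carrier G" "ord c = 2" and d: "d \<in> carrier G" "ord d = 2"
    using s a ord_conjugate by (simp_all add: c_def d_def)
  have ca: "c \<otimes> a = a \<otimes> s" and da: "d \<otimes> a = a \<otimes> c"
    using s a c by (simp_all add: c_def d_def m_assoc)
  have "c \<noteq> s"
    using ca neq by auto
  moreover have "d \<noteq> c"
  proof
    assume "d = c"
    then have "a \<otimes> c = a \<otimes> s"
      using ca da by simp
    then show False
      using \<open>c \<noteq> s\<close> a s c by simp
  qed
  ultimately consider "d = s" | "d = c \<otimes> s"
    using planar_imp_third_involution[OF pl c s _ d] by blast
  then show ?thesis
  proof cases
    case 1
    have "(a \<otimes> a) \<otimes> s = (a \<otimes> c) \<otimes> a"
      using ca a c s by (simp add: m_assoc)
    also have "\<dots> = s \<otimes> (a \<otimes> a)"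
      unfolding da[symmetric] 1 using a s by (simp add: m_assoc)
    finally show ?thesis
      by simp
  next
    case 2
    then show ?thesis
      by (simp add: c_def d_def)
  qed
qed

text \<open>\<open>a\<close> is itself a power of \<open>a [^] m\<close>. For order 3 this applies
  with exponent 2, for order 5 with exponents 2 and 3.\<close>

lemma commute_of_commute_pow:
  assumes "s \<in> carrier G" "a \<in> carrier G" "s \<otimes> a [^] (m :: nat) = a [^] m \<otimes> s" "a [^] (m * n) = a"
  shows "s \<otimes> a = a \<otimes> s"
  using commute_int_pow[of s "a [^] m" "int n"] assms by (simp add: int_pow_int nat_pow_pow)

text \<open>An involution not commuting with \<open>a\<close> is moved in a 3-cycle, which is the
  alternating configuration. Hence \<open>a\<close> centralizes all involutions, and two of them
  would give the direct product with a Klein four-group.\<close>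

lemma planar_imp_involution_unique_of_order_3:
  assumes pl: "planar (prime_order_graph G)" and a: "a \<in> carrier G" "ord a = 3"
    and s: "s \<in> carrier G" "ord s = 2" and t: "t \<in> carrier G" "ord t = 2"
  shows "s = t"
proof (rule ccontr)
  assume "s \<noteq> t"
  have "a \<otimes> (a \<otimes> a) = \<one>"
    using pow_eq_id[of a 3] a by (simp add: numeral_3_eq_3 m_assoc)
  then have a4: "a [^] (2 * 2 :: nat) = a"
    using a by (simp add: numeral_eq_Suc m_assoc)
  have comm: "a \<otimes> x = x \<otimes> a" if x: "x \<in> carrier G" "ord x = 2" for x
  proof (rule ccontr)
    assume neq: "a \<otimes> x \<noteq> x \<otimes> a"
    consider "(a \<otimes> a) \<otimes> x = x \<otimes> (a \<otimes> a)" | "a \<otimes> (a \<otimes> x \<otimes> inv a) \<otimes> inv a = a \<otimes> x \<otimes> inv a \<otimes> x"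
      using planar_imp_commute_pow[OF pl x a(1) neq] by blast
    then show False
    proof cases
      case 1
      have "a [^] (2 :: nat) = a \<otimes> a"
        using a by (simp add: numeral_2_eq_2)
      then have "x \<otimes> a [^] (2 :: nat) = a [^] (2 :: nat) \<otimes> x"
        using 1 by metis
      then have "x \<otimes> a = a \<otimes> x"
        using commute_of_commute_pow[OF x(1) a(1) _ a4] by blast
      then show False
        using neq by simp
    next
      case 2
      define c where "c = a \<otimes> x \<otimes> inv a"
      have c: "c \<in> carrier G" "ord c = 2"
        using a x ord_conjugate by (simp_all add: c_def)
      have "c \<otimes> a = a \<otimes> x"
        using a x by (simp add: c_def m_assoc)
      then have "c \<noteq> x"
        using neq by auto
      moreover have "a \<otimes> c \<otimes> inv a = c \<otimes> x"
        using 2 by (simp only: c_def)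
      ultimately show False
        using nonplanar_alternating_4[OF a x c_def _ planar_imp_involutions_commute[OF pl c x]] pl by blast
    qed
  qed
  have ne: "s \<noteq> \<one>" "t \<noteq> \<one>" "s \<otimes> t \<noteq> \<one>"
  proof -
    show "s \<noteq> \<one>" "t \<noteq> \<one>"
      using s t by auto
    have "inv t = t"
      using involution_pow(1)[OF t] t inv_equality by blast
    then show "s \<otimes> t \<noteq> \<one>"
      using s t \<open>s \<noteq> t\<close> inv_equality[of s t] by auto
  qed
  have "int (ord s) dvd i \<and> int (ord t) dvd j \<and> int (ord a) dvd k"
    if w: "s [^] i \<otimes> t [^] j \<otimes> a [^] k = \<one>" for i j k :: int
  proof -
    define v where "v = s [^] i \<otimes> t [^] j"
    have v: "v \<in> carrier G"
      using s t by (simp add: v_def)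
    have vv: "v \<otimes> v = \<one>"
    proof -
      have "v \<otimes> v = s [^] i \<otimes> (t [^] j \<otimes> s [^] i) \<otimes> t [^] j"
        using s t by (simp add: v_def m_assoc)
      also have "\<dots> = (s [^] i \<otimes> s [^] i) \<otimes> (t [^] j \<otimes> t [^] j)"
        using s t planar_imp_involutions_commute[OF pl t s] by (simp add: int_pow_commute m_assoc)
      also have "\<dots> = \<one>"
        using s t int_pow_eq_id[of s "2 * i"] int_pow_eq_id[of t "2 * j"] by (simp flip: int_pow_mult)
      finally show ?thesis .
    qed
    have vk: "v = inv (a [^] k)"
      using w v a inv_equality[of v "a [^] k"] unfolding v_def[symmetric] by simp
    then have "inv (a [^] k \<otimes> a [^] k) = \<one>"
      using vv a by (simp add: inv_mult_group)
    then have "a [^] k \<otimes> a [^] k = \<one>"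
      using a by (metis int_pow_closed inv_inv inv_one m_closed)
    then have "3 dvd k + k"
      using int_pow_mult[OF a(1), of k k] int_pow_eq_id[OF a(1), of "k + k"] a(2) by simp
    then have k: "3 dvd k"
      by presburger
    then have "v = \<one>"
      using vk a int_pow_eq_id[of a k] by simp
    then have "even i \<and> even j"
      using ne s t unfolding v_def involution_pow(2)[OF s] involution_pow(2)[OF t] by (auto split: if_splits)
    then show ?thesis
      using k a s t by simp
  qed
  then have "independent s t a"
    using s t a comm planar_imp_involutions_commute[OF pl s t] by (simp add: independent_def word_def)
  then show False
    using nonplanar_klein_times_3 s t a pl by blast
qed

text \<open>For \<open>x\<close> outside the group generated by \<open>a\<close>, the cosets in
  \<open>nonplanar_ord_5_coset\<close> have a common element \<open>y\<close>. Its square is a power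
  of \<open>a\<close>, so its fifth power is an involution; this commutes with \<open>a\<close>, and
  a cyclic group of order 10 appears.\<close>

lemma planar_imp_order_5_generates:
  assumes pl: "planar (prime_order_graph G)" and a: "a \<in> carrier G" "ord a = 5"
  shows "carrier G = range (\<lambda>i :: int. a [^] i)"
proof (rule ccontr)
  assume "carrier G \<noteq> range (\<lambda>i :: int. a [^] i)"
  then obtain x where x: "x \<in> carrier G" "x \<notin> range (\<lambda>i :: int. a [^] i)"
    using a by blast
  obtain i j :: int where ij: "x \<otimes> a [^] i = a [^] j \<otimes> inv x"
    using nonplanar_ord_5_coset[OF a x(1)] pl by blast
  define y where "y = x \<otimes> a [^] i"
  have y: "y \<in> carrier G"
    using x a by (simp add: y_def)
  have y_not: "y \<notin> range (\<lambda>i :: int. a [^] i)"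
  proof
    assume "y \<in> range (\<lambda>i :: int. a [^] i)"
    then obtain k :: int where "x \<otimes> a [^] i = a [^] k"
      by (auto simp: y_def)
    then have "x = a [^] k \<otimes> inv (a [^] i)"
      using x a by (metis int_pow_closed inv_solve_right)
    then have "x = a [^] (k - i)"
      using a by (simp add: int_pow_diff)
    then show False
      using x by blast
  qed
  \<comment> \<open>One factor is written as \<open>a [^] j \<otimes> inv x\<close> and the other as
    \<open>x \<otimes> a [^] i\<close>, so that \<open>x\<close> cancels.\<close>
  have yy: "y \<otimes> y = a [^] (j + i)"
  proof -
    have "y \<otimes> y = (a [^] j \<otimes> inv x) \<otimes> (x \<otimes> a [^] i)"
      by (simp add: y_def ij)
    also have "\<dots> = a [^] j \<otimes> (inv x \<otimes> x) \<otimes> a [^] i"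
      using x a by (simp only: m_assoc m_closed inv_closed int_pow_closed)
    also have "\<dots> = a [^] (j + i)"
      using x a by (simp add: int_pow_mult)
    finally show ?thesis .
  qed
  have y2: "y [^] (2 :: nat) = a [^] (j + i)"
    using y yy by (simp add: numeral_2_eq_2)
  have y2n: "y [^] (2 * n) = a [^] ((j + i) * int n)" for n :: nat
    using y a y2 nat_pow_pow[OF y, of 2 n] int_pow_pow[OF a(1), of "j + i" "int n"] by (simp add: int_pow_int)
  \<comment> \<open>\<open>y [^] 10\<close> is a fifth power of a power of \<open>a\<close>, hence
    trivial. If \<open>y [^] 5\<close> were trivial too, then \<open>y = y [^] 6\<close> would be a
    power of \<open>a\<close>.\<close>
  define s where "s = y [^] (5 :: nat)"
  have "ord s = 2"
  proof (rule ord_eq_primeI)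
    have "s [^] (2::nat) = y [^] (2 * 5 :: nat)"
      using y nat_pow_pow[OF y, of 5 2] by (simp add: s_def mult.commute)
    then show "s [^] (2::nat) = \<one>"
      unfolding y2n using a by (simp add: int_pow_eq_id)
    show "s \<noteq> \<one>"
    proof
      assume "s = \<one>"
      then have "y = s \<otimes> y"
        using y by simp
      also have "\<dots> = y [^] (2 * 3 :: nat)"
        using y by (simp add: s_def numeral_eq_Suc)
      finally show False
        using y_not unfolding y2n by blast
    qed
  qed (use y in \<open>simp_all add: s_def\<close>)
  then have s: "s \<in> carrier G" "ord s = 2"
    using y by (simp_all add: s_def)
  have pow6: "a [^] (2 * 3 :: nat) = a" "a [^] (3 * 2 :: nat) = a"
  proof -
    have "a [^] (5 :: nat) = \<one>"
      using pow_eq_id[of a 5] a by simp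
    then have "a [^] (5 :: nat) \<otimes> a = a"
      using a by simp
    then show "a [^] (2 * 3 :: nat) = a" "a [^] (3 * 2 :: nat) = a"
      using a by (simp_all add: numeral_eq_Suc)
  qed
  have comm: "s \<otimes> a = a \<otimes> s"
  proof (rule ccontr)
    assume neq: "s \<otimes> a \<noteq> a \<otimes> s"
    consider "(a \<otimes> a) \<otimes> s = s \<otimes> (a \<otimes> a)" | "a \<otimes> (a \<otimes> s \<otimes> inv a) \<otimes> inv a = a \<otimes> s \<otimes> inv a \<otimes> s"
      using planar_imp_commute_pow[OF pl s a(1)] neq by metis
    then show False
    proof cases
      case 1
      have "a [^] (2 :: nat) = a \<otimes> a"
        using a by (simp add: numeral_2_eq_2)
      then have "s \<otimes> a [^] (2 :: nat) = a [^] (2 :: nat) \<otimes> s"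
        using 1 by metis
      then have "s \<otimes> a = a \<otimes> s"
        using commute_of_commute_pow[OF s(1) a(1) _ pow6(1)] by blast
      then show False
        using neq by simp
    next
      case 2
      \<comment> \<open>The involutions \<open>s\<close>, \<open>c\<close>, \<open>d\<close> are
        permuted cyclically by conjugation with \<open>a\<close>, so \<open>a [^] 3\<close>
        centralizes \<open>s\<close>, and then so does \<open>a = (a [^] 3) [^] 2\<close>.\<close>
      define c d where "c = a \<otimes> s \<otimes> inv a" and "d = a \<otimes> c \<otimes> inv a"
      have c: "c \<in> carrier G" "ord c = 2" and d: "d \<in> carrier G"
        using a s ord_conjugate by (simp_all add: c_def d_def)
      have dcs: "d = c \<otimes> s"
        using 2 by (simp add: c_def d_def)
      have ca: "a \<otimes> s = c \<otimes> a" and da: "a \<otimes> c = d \<otimes> a"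
        using s a c by (simp_all add: c_def d_def m_assoc)
      have "a \<otimes> d = (a \<otimes> c) \<otimes> s"
        using a c s by (simp add: dcs m_assoc)
      also have "\<dots> = d \<otimes> (a \<otimes> s)"
        unfolding da using a d s by (simp add: m_assoc)
      also have "\<dots> = (d \<otimes> c) \<otimes> a"
        unfolding ca using a c d by (simp add: m_assoc)
      also have "d \<otimes> c = s \<otimes> (c \<otimes> c)"
        unfolding dcs planar_imp_involutions_commute[OF pl c s] using c s by (simp add: m_assoc)
      finally have ad: "a \<otimes> d = s \<otimes> a"
        using involution_pow(1)[OF c] s by simp
      have "a \<otimes> (a \<otimes> (a \<otimes> s)) = a \<otimes> ((a \<otimes> c) \<otimes> a)"
        unfolding ca using a c by (simp add: m_assoc)
      also have "\<dots> = (a \<otimes> d) \<otimes> (a \<otimes> a)"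
        unfolding da using a d by (simp add: m_assoc)
      also have "\<dots> = s \<otimes> (a \<otimes> (a \<otimes> a))"
        unfolding ad using a s by (simp add: m_assoc)
      finally have "s \<otimes> a [^] (3::nat) = a [^] (3::nat) \<otimes> s"
        using a s by (simp add: numeral_3_eq_3 m_assoc)
      then have "s \<otimes> a = a \<otimes> s"
        using commute_of_commute_pow[OF s(1) a(1) _ pow6(2)] by blast
      then show False
        using neq by simp
    qed
  qed
  have "int (ord s) dvd k \<and> int (ord a) dvd l" if w: "s [^] k \<otimes> a [^] l = \<one>" for k l :: int
  proof -
    have "even k"
    proof (rule ccontr)
      assume "odd k"
      then have "s \<otimes> a [^] l = \<one>"
        using w involution_pow(2)[OF s] by simp
      then have "inv s = a [^] l"
        using s a comm commute_int_pow[OF s(1) a(1)] inv_equality[of "a [^] l" s] by simp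
      then have sl: "s = a [^] l"
        using involution_pow(1)[OF s] s inv_equality by metis
      then have "a [^] (l + l) = \<one>"
        using involution_pow(1)[OF s] int_pow_mult[OF a(1), of l l] by simp
      then have "5 dvd l + l"
        using int_pow_eq_id[OF a(1), of "l + l"] a(2) by simp
      then have "5 dvd l"
        by presburger
      then have "s = \<one>"
        using sl a by (simp add: int_pow_eq_id)
      then show False
        using s by simp
    qed
    then show ?thesis
      using w s a involution_pow(2)[OF s, of k] int_pow_eq_id[of a l] by simp
  qed
  then have "independent s a \<one>"
    using s a comm by (simp add: independent_def word_def)
  then show False
    using nonplanar_cyclic_10 s a pl by blast
qed

section \<open>Cyclic groups and subgroups of prime order\<close>

lemma iso_integer_mod_group:
  assumes a: "a \<in> carrier G" "ord a = n" "n > 0" and gen: "carrier G = range (\<lambda>i :: int. a [^] i)"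
  shows "G \<cong> integer_mod_group n"
proof -
  have "(\<lambda>i :: int. a [^] i) \<in> iso (integer_mod_group n) G"
  proof (rule isoI)
    show "(\<lambda>i :: int. a [^] i) \<in> hom (integer_mod_group n) G"
      using a by (intro homI) (simp_all add: int_pow_eq minus_mod_eq_mult_div flip: int_pow_mult)
    have "inj_on (\<lambda>i :: int. a [^] i) {0..<int n}"
    proof (rule inj_onI)
      fix i j assume "i \<in> {0..<int n}" "j \<in> {0..<int n}" "a [^] i = a [^] j"
      then show "i = j"
        using a int_pow_eq[of a i j] zdvd_imp_le[of "int n" "j - i"] zdvd_imp_le[of "int n" "i - j"]
        by (cases i j rule: linorder_cases) (auto simp: dvd_diff_commute)
    qed
    moreover have "(\<lambda>i :: int. a [^] i) ` {0..<int n} = range (\<lambda>i :: int. a [^] i)"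
    proof -
      have "a [^] i = a [^] (i mod int n)" for i :: int
        using a by (simp add: int_pow_eq) (metis dvd_diff_commute dvd_minus_mod)
      moreover have "i mod int n \<in> {0..<int n}" for i
        using a(3) by simp
      ultimately show ?thesis
        by blast
    qed
    ultimately show "bij_betw (\<lambda>i :: int. a [^] i) (carrier (integer_mod_group n)) (carrier G)"
      using a(3) gen by (simp add: bij_betw_def carrier_integer_mod_group)
  qed
  then have "integer_mod_group n \<cong> G"
    by (auto simp: is_iso_def)
  then show ?thesis
    by (rule group.iso_sym[OF group_integer_mod_group])
qed

lemma pow_card_subgroup_eq_one:
  assumes "subgroup H G" "x \<in> H"
  shows "x [^] card H = \<one>"
proof -
  interpret H: group "G\<lparr>carrier := H\<rparr>"
    using assms(1) subgroup.subgroup_is_group is_group by blast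
  show ?thesis
    using H.pow_order_eq_1[of x] assms(2) nat_pow_consistent[of x "card H" H] by (simp add: order_def)
qed

lemma subgroup_int_pow_closed:
  assumes "subgroup H G" "x \<in> H"
  shows "x [^] (i :: int) \<in> H"
  using assms group.int_pow_closed[OF subgroup.subgroup_is_group[OF assms(1) is_group], of x i]
  by (simp add: int_pow_consistent)

lemma card_range_int_pow:
  assumes "x \<in> carrier G"
  shows "card (range (\<lambda>i :: int. x [^] i)) = ord x"
proof -
  have "generate G {x} = range (\<lambda>i :: int. x [^] i)"
    using generate_pow[OF assms] by auto
  then show ?thesis
    using generate_pow_card[OF assms] by simp
qed

lemma subgroup_prime_card:
  assumes "subgroup H G" "card H = p" "prime p"
  obtains x where "x \<in> H" "ord x = p" "H = range (\<lambda>i :: int. x [^] i)"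
proof -
  have "1 < card H"
    using assms(2,3) prime_gt_1_nat by simp
  then have "\<not> H \<subseteq> {\<one>}" and fin: "finite H"
    using card_mono[of "{\<one>}" H] card_ge_0_finite[of H] by auto
  then obtain x where x: "x \<in> H" "x \<noteq> \<one>"
    by blast
  then have xG: "x \<in> carrier G"
    using assms(1) subgroup.subset by blast
  have ord: "ord x = p"
    using ord_eq_primeI[OF xG x(2) assms(3)] pow_card_subgroup_eq_one[OF assms(1) x(1)] assms(2) by simp
  have "range (\<lambda>i :: int. x [^] i) \<subseteq> H"
    using subgroup_int_pow_closed[OF assms(1) x(1)] by blast
  then have "H = range (\<lambda>i :: int. x [^] i)"
    using card_subset_eq[OF fin] card_range_int_pow[OF xG] ord assms(2) by metis
  then show ?thesis
    using that x ord by blast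
qed

lemma cauchy:
  assumes "finite (carrier G)" "prime p" "p dvd order G"
  obtains x where "x \<in> carrier G" "ord x = p"
proof -
  obtain m where "order G = p ^ 1 * m"
    using assms(3) by auto
  then obtain H where "subgroup H G" "card H = p"
    using sylow_thm[OF assms(2) is_group _ assms(1)] by (metis power_one_right)
  then show ?thesis
    using subgroup_prime_card[of H p] that assms(2) subgroup.subset by (metis subsetD)
qed

text \<open>A subgroup of order \<open>p\<close> consists of the powers of any of its elements of
  order \<open>p\<close>, so uniqueness is a comparison of elements.\<close>

lemma unique_subgroup_prime_card:
  assumes "finite (carrier G)" "prime p" "p dvd order G"
    and uniq: "\<And>x y. x \<in> carrier G \<Longrightarrow> ord x = p \<Longrightarrow> y \<in> carrier G \<Longrightarrow> ord y = p \<Longrightarrow>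
      y \<in> range (\<lambda>i :: int. x [^] i)"
  shows "\<exists>!H. subgroup H G \<and> card H = p"
proof -
  obtain m where "order G = p ^ 1 * m"
    using assms(3) by auto
  then obtain H where H: "subgroup H G" "card H = p"
    using sylow_thm[OF assms(2) is_group _ assms(1)] by (metis power_one_right)
  have "K \<subseteq> H" if K: "subgroup K G" "card K = p" for K
  proof -
    obtain x where x: "x \<in> H" "ord x = p"
      using subgroup_prime_card[OF H assms(2)] by blast
    obtain y where y: "y \<in> K" "ord y = p" "K = range (\<lambda>i :: int. y [^] i)"
      using subgroup_prime_card[OF K assms(2)] by blast
    have "y \<in> range (\<lambda>i :: int. x [^] i)"
      using uniq x y(1,2) subgroup.subset[OF H(1)] subgroup.subset[OF K(1)] by blast
    then have "y \<in> H"
      using subgroup_int_pow_closed[OF H(1) x(1)] by blast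
    then show ?thesis
      using y(3) subgroup_int_pow_closed[OF H(1)] by blast
  qed
  moreover have "finite H"
    using subgroup.subset[OF H(1)] assms(1) finite_subset by blast
  ultimately have "K = H" if "subgroup K G" "card K = p" for K
    using that H(2) card_subset_eq by metis
  then show ?thesis
    using H by blast
qed

section \<open>Cyclicity of 3-groups with one subgroup of order 3\<close>

text \<open>\<open>H\<close> has fewer than \<open>n\<close> right cosets of \<open>M\<close>, so
  \<open>(m, i) \<mapsto> m \<otimes> x i\<close> is not injective. Suitable choices of
  \<open>x\<close> replace the usual facts on maximal subgroups of 3-groups, including
  normality.\<close>

lemma coset_pigeonhole:
  assumes M: "subgroup M G" and H: "subgroup H G" "finite H" "M \<subseteq> H" "card H < n * card M"
    and x: "\<And>i. i < n \<Longrightarrow> x i \<in> H"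
  obtains i j :: nat where "i < j" "j < n" "x i \<otimes> inv (x j) \<in> M"
proof -
  define f where "f = (\<lambda>(m, i). m \<otimes> x i)"
  have sub: "M \<subseteq> carrier G" "H \<subseteq> carrier G"
    using M H subgroup.subset by blast+
  have "f ` (M \<times> {..<n}) \<subseteq> H"
    using H(1,3) x by (auto simp: f_def subgroup.m_closed)
  then have "\<not> inj_on f (M \<times> {..<n})"
    using card_inj_on_le[of f "M \<times> {..<n}" H] H(2,4) by (auto simp: card_cartesian_product mult.commute)
  then obtain m m' i i' where *: "m \<in> M" "m' \<in> M" "i < n" "i' < n" "(m, i) \<noteq> (m', i')" "m \<otimes> x i = m' \<otimes> x i'"
    by (auto simp: inj_on_def f_def)
  then have c: "m \<in> carrier G" "m' \<in> carrier G" "x i \<in> carrier G" "x i' \<in> carrier G"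
    using sub x by auto
  have "i \<noteq> i'"
    using * c by auto
  have xi: "x i = inv m \<otimes> m' \<otimes> x i'"
    using *(6) c by (metis inv_closed inv_solve_left m_assoc m_closed)
  then have d: "x i \<otimes> inv (x i') = inv m \<otimes> m'"
    using c by (simp add: m_assoc)
  then have d1: "x i \<otimes> inv (x i') \<in> M"
    using * M subgroup.m_closed subgroup.m_inv_closed by metis
  moreover have "x i' \<otimes> inv (x i) = inv (x i \<otimes> inv (x i'))"
    using c by (simp add: inv_mult_group)
  then have "x i' \<otimes> inv (x i) \<in> M"
    using d1 M subgroup.m_inv_closed by metis
  ultimately show ?thesis
    using that[of i i'] that[of i' i] *(3,4) \<open>i \<noteq> i'\<close> by (metis linorder_neqE_nat)
qed

lemma int_pow_conjugate:
  assumes "x \<in> carrier G" "y \<in> carrier G" "z \<in> carrier G" "x \<otimes> y = y \<otimes> z"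
  shows "x [^] (i :: int) \<otimes> y = y \<otimes> z [^] i"
proof -
  have nat: "x [^] n \<otimes> y = y \<otimes> z [^] n" for n :: nat
  proof (induction n)
    case (Suc n)
    have "x [^] Suc n \<otimes> y = x [^] n \<otimes> (x \<otimes> y)"
      using assms(1-3) by (simp add: m_assoc)
    also have "\<dots> = (x [^] n \<otimes> y) \<otimes> z"
      unfolding assms(4) using assms(1-3) by (simp add: m_assoc)
    also have "\<dots> = y \<otimes> z [^] Suc n"
      unfolding Suc using assms(1-3) by (simp add: m_assoc)
    finally show ?case .
  qed (use assms in simp)
  show ?thesis
  proof (cases i rule: int_cases2)
    case (nonneg n)
    then show ?thesis
      using nat by (simp add: int_pow_int)
  next
    case (nonpos n)
    have "inv (x [^] n) \<otimes> y = inv (x [^] n) \<otimes> (y \<otimes> z [^] n) \<otimes> inv (z [^] n)"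
      using assms(1-3) by (simp add: m_assoc)
    also have "\<dots> = y \<otimes> inv (z [^] n)"
      unfolding nat[symmetric] using assms(1-3) by (simp add: m_assoc[symmetric])
    finally show ?thesis
      using nonpos assms(1-3) by (simp add: int_pow_neg int_pow_int)
  qed
qed

text \<open>
  For \<open>b\<close> normalizing but outside the maximal subgroup \<open>\<langle>a\<rangle>\<close>, either \<open>b\<close> generates everything or
  \<open>b \<otimes> a [^] t\<close> has order 3 for a suitable \<open>t\<close>: its cube is \<open>b [^] 3 \<otimes> a [^] (t * (1 + r + r\<^sup>2))\<close>
  where \<open>b\<close> acts as \<open>a \<mapsto> a [^] r\<close>, and \<open>r \<equiv> 1 (mod 3)\<close> makes \<open>1 + r + r\<^sup>2\<close> divisible by 3 only once.
\<close>

lemma cyclic_3_subgroup: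
  assumes fin: "finite (carrier G)"
    and uniq: "\<And>x y. x \<in> carrier G \<Longrightarrow> ord x = 3 \<Longrightarrow> y \<in> carrier G \<Longrightarrow> ord y = 3 \<Longrightarrow> y = x \<or> y = inv x"
  shows "subgroup H G \<Longrightarrow> card H = 3 ^ n \<Longrightarrow> \<exists>h\<in>H. H = range (\<lambda>i :: int. h [^] i)"
proof (induction n arbitrary: H)
  case 0
  then obtain x where "H = {x}"
    by (auto simp: card_1_singleton_iff)
  then have "H = {\<one>}"
    using subgroup.one_closed[OF 0(1)] by simp
  then show ?case
    by auto
next
  case (Suc n)
  have Hsub: "H \<subseteq> carrier G" and Hfin: "finite H"
    using subgroup.subset[OF Suc.prems(1)] fin finite_subset by blast+
  interpret H: group "G\<lparr>carrier := H\<rparr>"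
    using Suc.prems(1) subgroup.subgroup_is_group is_group by blast
  obtain M where M': "subgroup M (G\<lparr>carrier := H\<rparr>)" "card M = 3 ^ n"
    using sylow_thm[of 3 "G\<lparr>carrier := H\<rparr>" n 3] H.is_group Suc.prems(2) Hfin by (auto simp: order_def)
  have M: "subgroup M G" and MH: "M \<subseteq> H"
    using incl_subgroup[OF Suc.prems(1) M'(1)] subgroup.subset[OF M'(1)] by simp_all
  obtain a where a: "a \<in> M" and Ma: "M = range (\<lambda>i :: int. a [^] i)"
    using Suc.IH[OF M M'(2)] by blast
  have aG: "a \<in> carrier G"
    using a MH Hsub by blast
  note Hm = subgroup.m_closed[OF Suc.prems(1)] and Hi = subgroup.m_inv_closed[OF Suc.prems(1)]
    and Mm = subgroup.m_closed[OF M] and Mi = subgroup.m_inv_closed[OF M]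
  have "M \<noteq> H"
    using M'(2) Suc.prems(2) by auto
  then obtain b where b: "b \<in> H" "b \<notin> M"
    using MH by blast
  have bG: "b \<in> carrier G"
    using b Hsub by blast
  have powM: "x [^] (i :: int) \<in> M" if "x \<in> M" for x i
    using subgroup_int_pow_closed[OF M that] .
  \<comment> \<open>All orders in \<open>H\<close> are odd, so \<open>x\<close> is a power of its
    square.\<close>
  have sqrt: "x \<in> M" if x: "x \<in> H" "x \<otimes> x \<in> M" for x
  proof -
    have xG: "x \<in> carrier G"
      using x Hsub by blast
    have "x [^] (3 ^ Suc n :: nat) = \<one>"
      using pow_card_subgroup_eq_one[OF Suc.prems(1) x(1)] Suc.prems(2) by simp
    moreover obtain k :: nat where "3 ^ Suc n + 1 = 2 * k"
      by (metis dvdE even_add odd_one odd_numeral even_power)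
    ultimately have "x [^] (2 * k) = x"
      using xG by (metis Suc_eq_plus1 l_one nat_pow_Suc)
    then have "(x \<otimes> x) [^] int k = x"
      using nat_pow_pow[OF xG, of 2 k] xG by (simp add: int_pow_int numeral_2_eq_2)
    then show ?thesis
      using powM[OF x(2), of "int k"] by simp
  qed
  \<comment> \<open>\<open>M\<close> has index 3 in \<open>H\<close>; four elements always include
    two from one coset.\<close>
  have card_lt: "card H < 4 * card M"
    by (simp add: M'(2) Suc.prems(2))
  note pigeon = coset_pigeonhole[OF M Suc.prems(1) Hfin MH card_lt]
  have invM: "x \<in> M" if "inv x \<in> M" "x \<in> carrier G" for x
    using subgroup.m_inv_closed[OF M that(1)] that(2) by simp
  have bb: "b \<otimes> b \<notin> M"
    using sqrt b by blast
  have Hpow: "x [^] (i :: int) \<in> H" if "x \<in> H" for x i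
    using subgroup_int_pow_closed[OF Suc.prems(1) that] .
  have bpow: "b [^] (i - j :: int) \<in> M" if "b [^] i \<otimes> inv (b [^] j) \<in> M" for i j
    using that bG by (simp add: int_pow_diff)
  have nth4: "i = 0 \<or> i = 1 \<or> i = 2 \<or> i = 3" if "i < 4" for i :: nat
    using that by linarith
  have b_pow_M: "b [^] (-1 :: int) \<notin> M" "b [^] (-2 :: int) \<notin> M"
  proof -
    show "b [^] (-1 :: int) \<notin> M"
      using invM[of b] b bG by (auto simp: int_pow_neg)
    have "b [^] (-2 :: int) = inv (b \<otimes> b)"
      using bG int_pow_mult[OF bG, of 1 1] by (simp add: int_pow_neg)
    then show "b [^] (-2 :: int) \<notin> M"
      using invM[of "b \<otimes> b"] bb bG by auto
  qed
  \<comment> \<open>Among the powers 0 to 3 of \<open>b\<close> two share a coset; exponent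
    differences 1 and 2 are excluded because \<open>b\<close> and \<open>b \<otimes> b\<close> lie
    outside \<open>M\<close>.\<close>
  have b3: "b [^] (3 :: int) \<in> M"
  proof -
    obtain i j :: nat where ij: "i < j" "j < 4" "b [^] int i \<otimes> inv (b [^] int j) \<in> M"
      using pigeon[of "\<lambda>i. b [^] int i"] Hpow[OF b(1)] by blast
    then have "b [^] (int i - int j) \<in> M"
      using bpow by blast
    moreover have "int i - int j = -1 \<or> int i - int j = -2 \<or> int i - int j = -3"
      using ij by linarith
    ultimately have "b [^] (-3 :: int) \<in> M"
      using b_pow_M by metis
    then show ?thesis
      using invM[of "b [^] (3::int)"] bG by (simp add: int_pow_neg)
  qed
  \<comment> \<open>The elements \<open>\<one>\<close>, \<open>b\<close>,
    \<open>b \<otimes> b\<close> represent all cosets of \<open>M\<close>, so \<open>b\<close>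
    generates \<open>H\<close> as soon as it generates \<open>M\<close>.\<close>
  have gen: "\<exists>h\<in>H. H = range (\<lambda>i :: int. h [^] i)" if ab: "a = b [^] (l :: int)" for l
  proof -
    have Mb: "\<exists>k :: int. m = b [^] k" if "m \<in> M" for m
      using that ab int_pow_pow[OF bG] by (auto simp: Ma)
    have "\<exists>k :: int. h = b [^] k" if h: "h \<in> H" for h
    proof -
      have hG: "h \<in> carrier G"
        using h Hsub by blast
      define x where "x i = (if i < 3 then b [^] int i else h)" for i :: nat
      have "x i \<in> H" for i
        using Hpow[OF b(1)] h by (simp add: x_def)
      then obtain i j :: nat where ij: "i < j" "j < 4" "x i \<otimes> inv (x j) \<in> M"
        using pigeon[of x] by blast
      have "j = 3"
      proof (rule ccontr)
        assume "j \<noteq> 3"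
        then have "b [^] (int i - int j) \<in> M"
          using ij bpow by (simp add: x_def)
        moreover have "int i - int j = -1 \<or> int i - int j = -2"
          using ij \<open>j \<noteq> 3\<close> by linarith
        ultimately show False
          using b_pow_M by metis
      qed
      then obtain k :: int where "b [^] int i \<otimes> inv h = b [^] k"
        using ij Mb by (auto simp: x_def)
      then have "b [^] int i = b [^] k \<otimes> h"
        using bG hG inv_solve_right[of "b [^] k" "b [^] int i" h] by auto
      then have "h = inv (b [^] k) \<otimes> b [^] int i"
        using bG hG by (simp add: m_assoc[symmetric])
      then have "h = b [^] (- k + int i)"
        by (simp only: int_pow_mult[OF bG] int_pow_neg[OF bG])
      then show ?thesis
        by blast
    qed
    then have "H = range (\<lambda>i :: int. b [^] i)"
      using Hpow[OF b(1)] by auto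
    then show ?thesis
      using b(1) by blast
  qed
  have ord_a: "ord a = 3 ^ n"
    using card_range_int_pow[OF aG] Ma M'(2) by simp
  obtain u :: int where u: "b [^] (3 :: int) = a [^] u"
    using b3 Ma by auto
  show ?case
  proof (cases "3 dvd u \<and> n > 0")
    case False
    have "coprime u (3 ^ n)"
    proof (cases "n = 0")
      case False
      then have "\<not> 3 dvd u"
        using \<open>\<not> (3 dvd u \<and> n > 0)\<close> by simp
      then have "coprime 3 u"
        using prime_imp_coprime[of "3 :: int" u] by simp
      then show ?thesis
        by (simp add: coprime_commute)
    qed simp
    then obtain v where "[u * v = 1] (mod 3 ^ n)"
      using cong_solve_coprime_int by blast
    then have "int (ord a) dvd 1 - u * v"
      by (simp add: ord_a cong_iff_dvd_diff dvd_diff_commute)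
    then have "a [^] (u * v) = a"
      using int_pow_eq[OF aG, of "u * v" 1] aG by simp
    then have "a = b [^] (3 * v)"
      using int_pow_pow[OF aG, of u v] int_pow_pow[OF bG, of 3 v] u by simp
    then show ?thesis
      by (rule gen)
  next
    case True
    then obtain s where s: "u = 3 * s"
      by blast
    \<comment> \<open>This is the normality of \<open>M\<close>. Of the four elements
      \<open>inv b\<close>, \<open>inv b \<otimes> a\<close>,
      \<open>inv b \<otimes> a [^] 2\<close>, \<open>\<one>\<close>, the last shares no coset with
      the others, as otherwise \<open>b\<close> would lie in \<open>M\<close>. So the conjugate of
      \<open>a\<close> or its square is in \<open>M\<close>, and \<open>sqrt\<close> settles the
      second case.\<close>
    have "inv b \<otimes> (a \<otimes> b) \<in> M"
    proof -
      define x where "x i = (if i < 3 then inv b \<otimes> a [^] int i else \<one>)" for i :: nat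
      have "x i \<in> H" for i
      proof -
        have "inv b \<in> H" "a [^] int i \<in> H" "\<one> \<in> H"
          using Hi[OF b(1)] Hpow[of a] a MH subgroup.one_closed[OF Suc.prems(1)] by auto
        then show ?thesis
          using Hm by (simp add: x_def)
      qed
      then obtain i j :: nat where ij: "i < j" "j < 4" "x i \<otimes> inv (x j) \<in> M"
        using pigeon[of x] by blast
      have "j \<noteq> 3"
      proof
        assume "j = 3"
        then have "inv b \<otimes> a [^] int i \<in> M"
          using ij aG bG by (simp add: x_def)
        then have "(inv b \<otimes> a [^] int i) \<otimes> inv (a [^] int i) \<in> M"
          using Mm Mi powM[OF a] by blast
        then have "inv b \<in> M"
          using aG bG by (simp add: m_assoc)
        then show False
          using invM[OF _ bG] b by blast
      qed
      then have "x i \<otimes> inv (x j) = inv b \<otimes> a [^] (int i - int j) \<otimes> b"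
        using ij aG bG by (simp add: x_def inv_mult_group int_pow_diff m_assoc)
      then have m: "inv b \<otimes> a [^] (int i - int j) \<otimes> b \<in> M"
        using ij by simp
      have conj: "inv b \<otimes> a [^] k \<otimes> b = (inv b \<otimes> (a \<otimes> b)) [^] k" for k :: int
      proof -
        have "a \<otimes> b = b \<otimes> (inv b \<otimes> (a \<otimes> b))"
          using aG bG by (simp add: m_assoc[symmetric])
        from int_pow_conjugate[OF aG bG _ this, of k] show ?thesis
          using aG bG by (simp add: m_assoc) (simp add: m_assoc[symmetric])
      qed
      define y where "y = inv b \<otimes> (a \<otimes> b)"
      have yH: "y \<in> H"
        using b(1) a MH Hm Hi unfolding y_def by blast
      then have yG: "y \<in> carrier G"
        using Hsub by blast
      have "y [^] (int i - int j) \<in> M"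
        using m conj by (simp add: y_def)
      moreover have "int i - int j = -1 \<or> int i - int j = -2"
        using ij \<open>j \<noteq> 3\<close> by linarith
      ultimately have "y [^] (-1 :: int) \<in> M \<or> y [^] (-2 :: int) \<in> M"
        by metis
      moreover have "y [^] (2 :: int) = y \<otimes> y"
        using int_pow_mult[OF yG, of 1 1] yG by simp
      ultimately have "y \<in> M \<or> y \<otimes> y \<in> M"
        using invM[of y] invM[of "y \<otimes> y"] yG by (auto simp: int_pow_neg)
      then show ?thesis
        using sqrt[OF yH] by (auto simp: y_def)
    qed
    then obtain r :: int where r: "inv b \<otimes> (a \<otimes> b) = a [^] r"
      using Ma by auto
    then have ab: "a \<otimes> b = b \<otimes> a [^] r"
      using aG bG by (metis inv_solve_left int_pow_closed m_closed)
    have move: "a [^] k \<otimes> b = b \<otimes> a [^] (r * k)" for k :: int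
      using int_pow_conjugate[OF aG bG _ ab, of k] aG by (simp add: int_pow_pow)
    have b3_eq: "b \<otimes> (b \<otimes> b) = a [^] u"
      using u int_pow_mult[OF bG, of 1 2] int_pow_mult[OF bG, of 1 1] bG by simp
    \<comment> \<open>Conjugation by the cube of \<open>b\<close>, a power of \<open>a\<close>,
      fixes \<open>a\<close>. Hence \<open>r\<close> cubed is 1 modulo the order of
      \<open>a\<close>, in particular modulo 3.\<close>
    have "a \<otimes> (b \<otimes> (b \<otimes> b)) = b \<otimes> (b \<otimes> (b \<otimes> a [^] (r * (r * r))))"
    proof -
      have "a \<otimes> (b \<otimes> (b \<otimes> b)) = b \<otimes> (a [^] r \<otimes> b) \<otimes> b"
        using ab aG bG by (simp add: m_assoc[symmetric])
      also have "\<dots> = b \<otimes> (b \<otimes> (a [^] (r * r) \<otimes> b))"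
        unfolding move[of r] using aG bG by (simp add: m_assoc)
      also have "\<dots> = b \<otimes> (b \<otimes> (b \<otimes> a [^] (r * (r * r))))"
        unfolding move[of "r * r"] by simp
      finally show ?thesis .
    qed
    then have "a \<otimes> a [^] u = a [^] u \<otimes> a [^] (r * (r * r))"
      using b3_eq aG bG by (metis m_assoc m_closed int_pow_closed)
    then have "a [^] u \<otimes> a = a [^] u \<otimes> a [^] (r * (r * r))"
      using commute_int_pow[OF aG aG, of u] by simp
    then have "a [^] (1 :: int) = a [^] (r * (r * r))"
      using aG by simp
    then have "int (ord a) dvd r * (r * r) - 1"
      using int_pow_eq[OF aG] by blast
    moreover have "(3 :: int) dvd int (ord a)"
      using True by (simp add: ord_a)
    ultimately have r3: "(3 :: int) dvd r * (r * r) - 1"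
      using dvd_trans by blast
    have "3 dvd r - 1"
    proof -
      have "r mod 3 = 0 \<or> r mod 3 = 1 \<or> r mod 3 = 2"
        by presburger
      moreover have "(r * (r * r)) mod 3 = 1"
        using r3 mod_eq_dvd_iff[of "r * (r * r)" 3 1] by simp
      ultimately have "r mod 3 = 1"
        by (auto simp: mod_mult_eq[of r 3 "r * r", symmetric] mod_mult_eq[of r 3 r, symmetric])
      then show ?thesis
        by presburger
    qed
    then obtain v where v: "r = 1 + 3 * v"
      by (metis add.commute diff_add_cancel dvdE)
    \<comment> \<open>\<open>w\<close> is \<open>(1 + r + r * r) / 3\<close>. As \<open>w\<close> is
      invertible modulo \<open>3 ^ n\<close>, some \<open>t\<close> solves
      \<open>u + 3 * w * t = 0\<close> modulo the order of \<open>a\<close>, which makes the cube of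
      \<open>b \<otimes> a [^] t\<close> trivial.\<close>
    define w where "w = 1 + 3 * v + 3 * v * v"
    have "w = 1 + 3 * (v + v * v)"
      by (simp add: w_def algebra_simps)
    then have "\<not> 3 dvd w"
      by presburger
    then have "coprime w (3 ^ n)"
      using prime_imp_coprime[of "3 :: int" w] by (simp add: coprime_commute)
    then obtain t' where "[w * t' = 1] (mod 3 ^ n)"
      using cong_solve_coprime_int by blast
    then have t': "3 ^ n dvd w * t' - 1"
      by (simp add: cong_iff_dvd_diff)
    define t where "t = - s * t'"
    define c where "c = b \<otimes> a [^] t"
    have cG: "c \<in> carrier G"
      using aG bG by (simp add: c_def)
    have "c \<otimes> (c \<otimes> c) = b \<otimes> ((a [^] t \<otimes> b) \<otimes> ((a [^] t \<otimes> b) \<otimes> a [^] t))"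
      using aG bG by (simp add: c_def m_assoc)
    also have "\<dots> = b \<otimes> (b \<otimes> ((a [^] (r * t) \<otimes> b) \<otimes> (a [^] (r * t) \<otimes> a [^] t)))"
      unfolding move[of t] using aG bG by (simp add: m_assoc)
    also have "\<dots> = (b \<otimes> (b \<otimes> b)) \<otimes> (a [^] (r * (r * t)) \<otimes> (a [^] (r * t) \<otimes> a [^] t))"
      unfolding move[of "r * t"] using aG bG by (simp add: m_assoc)
    also have "\<dots> = a [^] (u + (r * (r * t) + (r * t + t)))"
      unfolding b3_eq using aG by (simp add: int_pow_mult)
    also have "u + (r * (r * t) + (r * t + t)) = - 3 * s * (w * t' - 1)"
      unfolding s v t_def w_def by (simp add: algebra_simps)
    also have "a [^] (- 3 * s * (w * t' - 1)) = \<one>"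
      using t' int_pow_eq_id[OF aG] ord_a by simp
    finally have ccc: "c \<otimes> (c \<otimes> c) = \<one>" .
    have cM: "c \<notin> M"
    proof
      assume "c \<in> M"
      then have "c \<otimes> inv (a [^] t) \<in> M"
        using powM[OF a] Mm Mi by blast
      then show False
        using b aG bG by (simp add: c_def m_assoc)
    qed
    have "ord c = 3"
    proof (rule ord_eq_primeI)
      show "c \<noteq> \<one>"
        using cM subgroup.one_closed[OF M] by blast
      show "c [^] (3 :: nat) = \<one>"
        using ccc cG by (simp add: numeral_3_eq_3 m_assoc)
    qed (use cG in simp_all)
    obtain k where k: "n = Suc k"
      using True gr0_implies_Suc by blast
    \<comment> \<open>\<open>M\<close> already contains an element \<open>d\<close> of order 3,
      while \<open>c\<close> of order 3 lies outside \<open>M\<close>; so \<open>c\<close> can be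
      neither \<open>d\<close> nor \<open>inv d\<close>.\<close>
    define d where "d = a [^] (3 ^ k :: nat)"
    have "ord d = 3"
      using ord_pow[OF aG, of "3 ^ k"] by (simp add: d_def ord_a k)
    have "d \<in> M"
      using powM[OF a, of "int (3 ^ k)"] by (simp only: d_def int_pow_int)
    then have "d \<in> carrier G" "inv d \<in> M"
      using MH Hsub Mi by blast+
    then show ?thesis
      using uniq[OF _ \<open>ord d = 3\<close> cG \<open>ord c = 3\<close>] cM \<open>d \<in> M\<close> by blast
  qed
qed
end

section \<open>The classification by prime divisors of the order\<close>

lemma eq_power_2_3:
  fixes n :: nat
  assumes "n > 0" "\<And>q. prime q \<Longrightarrow> q dvd n \<Longrightarrow> q = 2 \<or> q = 3"
  shows "n = 2 ^ multiplicity 2 n * 3 ^ multiplicity 3 n"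
proof (rule multiplicity_eq_nat)
  fix q :: nat assume q: "prime q"
  have distinct_primes: "multiplicity q (2 ^ i * 3 ^ j) = (if q = 2 then i else if q = 3 then j else 0)" for i j
    using q multiplicity_distinct_prime_power[of q 2 i] multiplicity_distinct_prime_power[of q 3 j]
    by (auto simp: prime_elem_multiplicity_mult_distrib)
  show "multiplicity q n = multiplicity q (2 ^ multiplicity 2 n * 3 ^ multiplicity 3 n)"
    using assms q not_dvd_imp_multiplicity_0[of q n] by (auto simp: distinct_primes)
qed (use assms in auto)

theorem theorem4p1:
  fixes G :: "('a, 'b) monoid_scheme" (structure)
  assumes "group G" and "finite (carrier G)"
    and "planar (prime_order_graph G)"
  shows "G \<cong> integer_mod_group 5
    \<or> (cyclic_group G \<and> (\<exists>k::nat. order G = 3 ^ k))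
    \<or> ((\<exists>k::nat. order G = 2 ^ k) \<and>
         (card {x \<in> carrier G. group.ord G x = 2} = 1 \<or>
          card {x \<in> carrier G. group.ord G x = 2} = 3))
    \<or> ((\<exists>m n :: nat. order G = 2 ^ m * 3 ^ n) \<and>
         (\<exists>!H. subgroup H G \<and> card H = 2) \<and> (\<exists>!K. subgroup K G \<and> card K = 3))"
proof -
  interpret group G
    by (rule assms(1))
  have pos: "order G > 0"
    using assms(2) order_gt_0_iff_finite by blast
  have primes: "q = 2 \<or> q = 3 \<or> q = 5" if "prime q" "q dvd order G" for q
  proof -
    obtain x where x: "x \<in> carrier G" "ord x = q"
      using cauchy[OF assms(2) \<open>prime q\<close> \<open>q dvd order G\<close>] by blast
    then have "q < 7"
      using nonplanar_prime_ge_7[of x] assms(3) that(1) by fastforce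
    moreover have "\<not> prime (4 :: nat)" "\<not> prime (6 :: nat)"
      by (auto simp: prime_nat_iff intro!: exI[of _ "2 :: nat"])
    moreover have "q \<ge> 2"
      using that(1) prime_ge_2_nat by blast
    ultimately show ?thesis
      using that(1) by (cases "q = 2 \<or> q = 3 \<or> q = 4 \<or> q = 5 \<or> q = 6") auto
  qed
  show ?thesis
  proof (cases "5 dvd order G")
    case True
    then obtain a where a: "a \<in> carrier G" "ord a = 5"
      using cauchy[OF assms(2), of 5] by auto
    then have "G \<cong> integer_mod_group 5"
      using iso_integer_mod_group planar_imp_order_5_generates[OF assms(3) a] by simp
    then show ?thesis
      by blast
  next
    case False
    then have ord_eq: "order G = 2 ^ multiplicity 2 (order G) * 3 ^ multiplicity 3 (order G)"
      using primes pos by (intro eq_power_2_3) auto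
    show ?thesis
    proof (cases "3 dvd order G")
      case False
      then have two: "order G = 2 ^ multiplicity 2 (order G)"
        using ord_eq by (simp add: not_dvd_imp_multiplicity_0)
      show ?thesis
      proof (cases "2 dvd order G")
        case True
        then obtain s where "s \<in> carrier G" "ord s = 2"
          using cauchy[OF assms(2), of 2] by auto
        then show ?thesis
          using card_involutions[OF assms(3)] two by blast
      next
        case False
        \<comment> \<open>The trivial group has no involution, so it belongs to the cyclic 3-groups,
          with exponent 0.\<close>
        then have one: "order G = 3 ^ 0"
          using two by (simp add: not_dvd_imp_multiplicity_0)
        then obtain x where "carrier G = {x}"
          by (auto simp: order_def card_1_singleton_iff)
        moreover from this have "x = \<one>"
          using one_closed by simp
        ultimately have "carrier G = range (\<lambda>i :: int. \<one> [^] i)"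
          by (simp add: image_constant_conv)
        then have "cyclic_group G"
          using cyclic_group by blast
        then show ?thesis
          using one by blast
      qed
    next
      case three: True
      have uniq3: "y = x \<or> y = inv x" if "x \<in> carrier G" "ord x = 3" "y \<in> carrier G" "ord y = 3" for x y
        using planar_imp_order_3_eq[OF assms(3)] that by blast
      obtain a where a: "a \<in> carrier G" "ord a = 3"
        using cauchy[OF assms(2) _ three] by auto
      show ?thesis
      proof (cases "2 dvd order G")
        case True
        have "\<exists>!H. subgroup H G \<and> card H = 2"
        proof (rule unique_subgroup_prime_card[OF assms(2) _ True])
          fix x y assume "x \<in> carrier G" "ord x = 2" "y \<in> carrier G" "ord y = 2"
          then have "y = x [^] (1 :: int)"
            using planar_imp_involution_unique_of_order_3[OF assms(3) a] by simp
          then show "y \<in> range (\<lambda>i :: int. x [^] i)"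
            by blast
        qed simp
        moreover have "\<exists>!K. subgroup K G \<and> card K = 3"
        proof (rule unique_subgroup_prime_card[OF assms(2) _ three])
          fix x y assume x: "x \<in> carrier G" "ord x = 3" and y: "y \<in> carrier G" "ord y = 3"
          have "y = x [^] (1 :: int) \<or> y = x [^] (-1 :: int)"
            using uniq3[OF x y] x by (simp add: int_pow_neg)
          then show "y \<in> range (\<lambda>i :: int. x [^] i)"
            by blast
        qed simp
        ultimately show ?thesis
          using ord_eq by blast
      next
        case False
        then obtain k where pow3: "order G = 3 ^ k"
          using ord_eq by (simp add: not_dvd_imp_multiplicity_0)
        then have "card (carrier G) = 3 ^ k"
          by (simp add: order_def)
        then have "cyclic_group G"
          using cyclic_3_subgroup[OF assms(2) uniq3 subgroup_self] cyclic_group by blast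
        then show ?thesis
          using pow3 by blast
      qed
    qed
  qed
qed

end
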